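(* Let $\big\{(\mathbf{x}^n(t),\mathbf{y}^n(t))_{t\ge 0}\big\}_{n\in\mathbb{N}}$ be the family of continuous time Markov chains on $\Theta_n$ described in the context, and let $(\mathbf{x}(t),\mathbf{y}(t))_{t\ge 0}$ be the solution of the ODE system $$\frac{d}{dt}\mathbf{x}(t)=F_x(\mathbf{x}(t),\mathbf{y}(t)),\qquad \frac{d}{dt}\mathbf{y}(t)=F_y(\mathbf{x}(t),\mathbf{y}(t)),\qquad \mathbf{x}(0)^T\mathbf{1}=\mathbf{y}(0)^T\mathbf{1}=1 .$$ Assume that for every $n\in\mathbb{N}$, $(\mathbf{x}(0),\mathbf{y}(0))=(\mathbf{x}^n(0),\mathbf{y}^n(0))$. Then for all $T\in(0,\infty)$, $$\lim_{n\to\infty}\ \sup_{0\le t\le T}\big\|(\mathbf{x}^n(t),\mathbf{y}^n(t))-(\mathbf{x}(t),\mathbf{y}(t))\big\|=0\quad\text{almost surely.}$$ More precisely, for any $\epsilon>0$ and $T\in(0,\infty)$, $$\mathbf{P}\Big(\sup_{0\le t\le T}\big\|(\mathbf{x}^n(t),\mathbf{y}^n(t))-(\mathbf{x}(t),\mathbf{y}(t))\big\|\ge\epsilon\Big)\le 4N(N-1)\exp\Big(-n(1+\kappa)T\cdot h\Big(\frac{\epsilon e^{-MT}}{\sqrt{2}\,N(N-1)(1+\kappa)T}\Big)\Big),$$ where $h(x)=(1+x)\log(1+x)-x$, $N$ is the number of nodes of the graph, and $M<\infty$ is the Lipschitz constant of $F=(F_x,F_y):S\to\mathbb{R}^{2N}$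 on the set $S=\{(\mathbf{x},\mathbf{y})\in\mathbb{R}^{2N}:\mathbf{x}^T\mathbf{1}=\mathbf{y}^T\mathbf{1}=1\}$.
   Context: $\mathcal{G}(\mathcal{N},\mathcal{E})$ is a finite, undirected, connected graph with $N=|\mathcal{N}|$ nodes, adjacency matrix $\mathbf{A}$ (entries $1$ for edges, $0$ otherwise), diagonal degree matrix $\mathbf{D}$, and combinatorial Laplacian $\mathbf{L}=\mathbf{D}-\mathbf{A}$. Set $\mathbf{Q}=-\mathbf{L}=\mathbf{A}-\mathbf{D}$, a transition rate matrix. $\kappa\in(0,\infty)$ is a fixed scalar. $\mathbf{1}$ is the all-ones vector, $\mathbf{e}_i$ the $i$-th canonical basis vector of $\mathbb{R}^N$, $\mathbf{D}_{\mathbf{v}}$ the diagonal matrix with diagonal $\mathbf{v}$, and $\|\cdot\|$ the Euclidean norm on $\mathbb{R}^{2N}$. Let $\Sigma=\{\mathbf{u}\in\mathbb{R}^N : \mathbf{u}^T\mathbf{1}=1,\ \mathbf{u}\ge 0\}$, $\Sigma_n=\Sigma\cap\{\tfrac1n\mathbf{u}:\mathbf{u}\in\mathbb{Z}^N\}$, and $\Theta_n=\Sigma_n\times\Sigma_n$. The process $(\mathbf{x}^n(t),\mathbf{y}^n(t))_{t\ge0}$ is the continuous time Markov chain on the finite state space $\Theta_n$ which, in state $(\mathbf{x},\mathbf{y})$, for each ordered pair of distinct nodes $j\ne i$, jumps by $\tfrac1n(\mathbf{e}_i-\mathbf{e}_j,\mathbf{0})$ at rate $\bar Q^n_{x:j\to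 i}(\mathbf{x},\mathbf{y})=n\big(Q_{ji}x_j+\kappa\, x_j y_j\, x_i\big)$ and by $\tfrac1n(\mathbf{0},\mathbf{e}_i-\mathbf{e}_j)$ at rate $\bar Q^n_{y:j\to i}(\mathbf{x},\mathbf{y})=n\big(Q_{ji}y_j+\kappa\, x_j y_j\, y_i\big)$. (It records the densities of two groups of $n$ random walkers each, on the graph.) The processes for all $n$ are defined on a common probability space with probability measure $\mathbf{P}$. The vector field $F=(F_x,F_y)$ is $$F_x(\mathbf{x},\mathbf{y})=\mathbf{Q}^T\mathbf{x}+[\kappa\,\mathbf{x}^T\mathbf{y}]\,\mathbf{x}-\kappa\,\mathbf{D}_{\mathbf{y}}\mathbf{x},\qquad F_y(\mathbf{x},\mathbf{y})=\mathbf{Q}^T\mathbf{y}+[\kappa\,\mathbf{x}^T\mathbf{y}]\,\mathbf{y}-\kappa\,\mathbf{D}_{\mathbf{x}}\mathbf{y}.$$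
   Formalization: M is taken as a Lipschitz constant of F on Σ×Σ (that is, S with x, y ≥ 0) instead of on S: for N ≥ 2, F is not Lipschitz on S, e.g. along x=(1+s,−s,0,…), y=e_1, where F_x grows quadratically in s, so M<∞ fails there. *)

theory Defs
  imports "HOL-Probability.Probability"
begin

section \<open>Graph matrices\<close>

text \<open>The node set is the (finite) type \<open>'v\<close>, so the number of nodes is \<open>CARD('v)\<close>. An undirected
  edge is represented by both of its orientations.\<close>

definition connected_graph :: "('v::finite \<times> 'v) set \<Rightarrow> bool" where
  "connected_graph E \<longleftrightarrow> sym E \<and> irrefl E \<and> (\<forall>u v. (u, v) \<in> E\<^sup>*)"

definition diag_mat :: "real ^ 'v \<Rightarrow> real ^ 'v ^ 'v" where
  "diag_mat v = (\<chi> i j. if i = j then v $ i else 0)"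

definition adj_mat :: "('v::finite \<times> 'v) set \<Rightarrow> real ^ 'v ^ 'v" where
  "adj_mat E = (\<chi> i j. if (i, j) \<in> E then 1 else 0)"

definition degree_mat :: "('v::finite \<times> 'v) set \<Rightarrow> real ^ 'v ^ 'v" where
  "degree_mat E = diag_mat (\<chi> i. real (card {j. (i, j) \<in> E}))"

definition laplacian :: "('v::finite \<times> 'v) set \<Rightarrow> real ^ 'v ^ 'v" where
  "laplacian E = degree_mat E - adj_mat E"

definition rate_mat :: "('v::finite \<times> 'v) set \<Rightarrow> real ^ 'v ^ 'v" where
  "rate_mat E = - laplacian E"


section \<open>State spaces and vector field\<close>

text \<open>The pair \<open>(x, y)\<close> lives in \<open>(real ^ 'v) \<times> (real ^ 'v)\<close>, whose norm in the library is
  the Euclidean norm of the concatenated vector. The order on \<open>real ^ 'v\<close> is componentwise, and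
  \<open>1 :: real ^ 'v\<close> is the all-ones vector.\<close>

definition simplex_set :: "(real ^ 'v::finite) set" where
  "simplex_set = {u. u \<bullet> 1 = 1 \<and> 0 \<le> u}"

definition lattice_simplex :: "nat \<Rightarrow> (real ^ 'v::finite) set" where
  "lattice_simplex n = simplex_set \<inter> {(1 / real n) *\<^sub>R u | u. \<forall>i. u $ i \<in> \<int>}"

definition state_space :: "nat \<Rightarrow> ((real ^ 'v::finite) \<times> (real ^ 'v)) set" where
  "state_space n = lattice_simplex n \<times> lattice_simplex n"

definition vector_field ::
  "('v::finite \<times> 'v) set \<Rightarrow> real \<Rightarrow> (real ^ 'v) \<times> (real ^ 'v) \<Rightarrow> (real ^ 'v) \<times> (real ^ 'v)" where
  "vector_field E \<kappa> = (\<lambda>(x, y).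
     (transpose (rate_mat E) *v x + (\<kappa> * (x \<bullet> y)) *\<^sub>R x - \<kappa> *\<^sub>R (diag_mat y *v x),
      transpose (rate_mat E) *v y + (\<kappa> * (x \<bullet> y)) *\<^sub>R y - \<kappa> *\<^sub>R (diag_mat x *v y)))"

text \<open>The domain on which the Lipschitz constant of the vector field is taken. The nonnegativity
  constraints are needed: on the whole affine space \<open>x \<bullet> 1 = y \<bullet> 1 = 1\<close> the vector field, a
  polynomial map of degree at least two, has no finite Lipschitz constant once the graph has two
  nodes. Any constant valid on a larger set is also valid on this one.\<close>

definition lipschitz_domain :: "((real ^ 'v::finite) \<times> (real ^ 'v)) set" where
  "lipschitz_domain = {(x, y). x \<bullet> 1 = 1 \<and> y \<bullet> 1 = 1 \<and> 0 \<le> x \<and> 0 \<le> y}"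


section \<open>Continuous time Markov chains on a finite state space\<close>

definition transition_function :: "'s set \<Rightarrow> (real \<Rightarrow> 's \<Rightarrow> 's \<Rightarrow> real) \<Rightarrow> bool" where
  "transition_function S p \<longleftrightarrow>
     (\<forall>t\<ge>0. \<forall>s\<in>S. (\<forall>s'\<in>S. 0 \<le> p t s s') \<and> (\<Sum>s'\<in>S. p t s s') = 1) \<and>
     (\<forall>s\<in>S. \<forall>s'\<in>S. p 0 s s' = (if s = s' then 1 else 0)) \<and>
     (\<forall>t\<ge>0. \<forall>h\<ge>0. \<forall>s\<in>S. \<forall>s'\<in>S. p (t + h) s s' = (\<Sum>r\<in>S. p t s r * p h r s'))"

text \<open>\<open>q s s'\<close> is the jump rate from \<open>s\<close> to \<open>s' \<noteq> s\<close>; the diagonal of \<open>q\<close> is irrelevant, since the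
  derivative of \<open>p t s s\<close> at \<open>0\<close> is determined by the row sums of \<open>p\<close> being \<open>1\<close>.\<close>

definition has_jump_rates ::
  "'s set \<Rightarrow> (real \<Rightarrow> 's \<Rightarrow> 's \<Rightarrow> real) \<Rightarrow> ('s \<Rightarrow> 's \<Rightarrow> real) \<Rightarrow> bool" where
  "has_jump_rates S p q \<longleftrightarrow>
     (\<forall>s\<in>S. \<forall>s'\<in>S. s \<noteq> s' \<longrightarrow>
        ((\<lambda>t. p t s s') has_real_derivative q s s') (at 0 within {0..}))"

text \<open>In the Markov property the past is a finite set \<open>J\<close> of times in \<open>{0..t}\<close> together with
  prescribed values \<open>\<sigma>\<close> at these times. The paths are right-continuous for the discrete topology
  on the state space.\<close>

definition markov_chain ::
  "'w measure \<Rightarrow> 's set \<Rightarrow> ('s \<Rightarrow> 's \<Rightarrow> real) \<Rightarrow> (real \<Rightarrow> 'w \<Rightarrow> 's) \<Rightarrow> bool" where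
  "markov_chain P S q X \<longleftrightarrow>
     (\<forall>t\<ge>0. X t \<in> measurable P (count_space S)) \<and>
     (\<forall>\<omega>\<in>space P. \<forall>t\<ge>0. \<exists>d>0. \<forall>u\<in>{t..<t + d}. X u \<omega> = X t \<omega>) \<and>
     (\<exists>p. transition_function S p \<and> has_jump_rates S p q \<and>
        (\<forall>J \<sigma> t h s s'. finite J \<and> J \<subseteq> {0..t} \<and> 0 \<le> t \<and> 0 \<le> h \<and> s \<in> S \<and> s' \<in> S \<and>
           measure P {\<omega> \<in> space P. X t \<omega> = s \<and> (\<forall>u\<in>J. X u \<omega> = \<sigma> u)} > 0 \<longrightarrow>
           cond_prob P (\<lambda>\<omega>. X (t + h) \<omega> = s') (\<lambda>\<omega>. X t \<omega> = s \<and> (\<forall>u\<in>J. X u \<omega> = \<sigma> u)) = p h s s'))"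


section \<open>Jump rates of the interacting walkers\<close>

definition rate_x ::
  "('v::finite \<times> 'v) set \<Rightarrow> real \<Rightarrow> nat \<Rightarrow> 'v \<Rightarrow> 'v \<Rightarrow> (real ^ 'v) \<times> (real ^ 'v) \<Rightarrow> real" where
  "rate_x E \<kappa> n j i = (\<lambda>(x, y). real n * (rate_mat E $ j $ i * x $ j + \<kappa> * x $ j * y $ j * x $ i))"

definition rate_y ::
  "('v::finite \<times> 'v) set \<Rightarrow> real \<Rightarrow> nat \<Rightarrow> 'v \<Rightarrow> 'v \<Rightarrow> (real ^ 'v) \<times> (real ^ 'v) \<Rightarrow> real" where
  "rate_y E \<kappa> n j i = (\<lambda>(x, y). real n * (rate_mat E $ j $ i * y $ j + \<kappa> * x $ j * y $ j * y $ i))"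

text \<open>Total rate from \<open>s\<close> to \<open>s'\<close>. For \<open>n \<ge> 1\<close> the possible jumps are pairwise different, so at most
  one summand is nonzero.\<close>

definition jump_rate ::
  "('v::finite \<times> 'v) set \<Rightarrow> real \<Rightarrow> nat \<Rightarrow>
     (real ^ 'v) \<times> (real ^ 'v) \<Rightarrow> (real ^ 'v) \<times> (real ^ 'v) \<Rightarrow> real" where
  "jump_rate E \<kappa> n s s' =
     (\<Sum>j\<in>UNIV. \<Sum>i\<in>UNIV - {j}.
        (if s' = s + ((1 / real n) *\<^sub>R (axis i 1 - axis j 1), 0) then rate_x E \<kappa> n j i s else 0) +
        (if s' = s + (0, (1 / real n) *\<^sub>R (axis i 1 - axis j 1)) then rate_y E \<kappa> n j i s else 0))"

definition h_fun :: "real \<Rightarrow> real" where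
  "h_fun x = (1 + x) * ln (1 + x) - x"

end

theory Submission
  imports Defs
begin

text \<open>Each coordinate of the chain, minus its drift, is a sum of jumps of size \<open>1 / n\<close> occurring at
  total rate at most \<open>n (N - 1) (1 + \<kappa>)\<close>, so exponential moments control its maximum. Only the
  derivative of the transition function at \<open>0\<close> is needed: on a grid of mesh \<open>d\<close> the one-step
  exponential moment is at most \<open>exp (d (c + \<eta>))\<close>, and the Markov property for finite histories
  propagates this to a maximal inequality. On the same grid, the discrete Gronwall inequality bounds
  the distance between the chain and the solution by the compensated coordinates plus the Euler error.
  Right-continuity of the paths carries the estimate through \<open>d \<longrightarrow> 0\<close>, and the exponential
  parameter is then optimised. A union bound over the \<open>2 N\<close> coordinates and the two signs gives \<open>4 N\<close>
  events. The almost sure statement follows by Borel-Cantelli.\<close>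

text \<open>The Lipschitz constant is available only on the product of two simplices. The chain
  lives there by construction; for the solution this is a separate invariance argument, which starts
  from the almost sure equality with the chain at time 0. The coordinatewise argument yields more
  than the stated constant. A deviation of norm \<epsilon> forces some compensated coordinate up to
  about \<epsilon> exp (- M T) / sqrt (2 N), and the optimal exponent is - n (N - 1) (1 + \<kappa>)
  T h (sqrt N * y), with y the argument of \<open>h_fun\<close> in the claim. As
  \<open>h_fun\<close> increases and N \<le> N (N - 1) for N \<ge> 2, the claim follows. For N = 1
  the claimed bound is 0 and the simplex is a point. The deviation event involves uncountably many
  times, and the mesh that detects a deviation depends on the path. So the event is enclosed in a
  measurable liminf of grid events, whose probability is at most every \<beta> above the bound; the
  strict inequality leaves room for the mesh and the other small errors.\<close>

context prob_space
begin

section \<open>Exponential maximal inequality along a time grid\<close>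

lemma pred_eq_process:
  assumes "X \<in> measurable M (count_space S)"
  shows "Measurable.pred M (\<lambda>\<omega>. X \<omega> = c)"
  by (rule measurable_compose[OF assms]) simp

lemma grid_sum_measurable:
  fixes X :: "real \<Rightarrow> 'a \<Rightarrow> 's" and \<xi> :: "'s \<Rightarrow> 's \<Rightarrow> real"
  assumes "finite S" "\<And>t. 0 \<le> t \<Longrightarrow> X t \<in> measurable M (count_space S)" "0 \<le> t" "0 \<le> d"
  shows "(\<lambda>\<omega>. \<Sum>l<k. \<xi> (X (t + real l * d) \<omega>) (X (t + real (Suc l) * d) \<omega>)) \<in> borel_measurable M"
proof (rule borel_measurable_sum)
  fix l
  have "(\<lambda>\<omega>. \<xi> s (X (t + real (Suc l) * d) \<omega>)) \<in> borel_measurable M" for s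
    by (rule measurable_compose[OF assms(2)]) (use assms in auto)
  moreover have "X (t + real l * d) \<in> measurable M (count_space S)"
    using assms by (intro assms) auto
  ultimately show "(\<lambda>\<omega>. \<xi> (X (t + real l * d) \<omega>) (X (t + real (Suc l) * d) \<omega>)) \<in> borel_measurable M"
    by (rule measurable_compose_countable'[where g="X (t + real l * d)" and I=S]) (simp_all add: countable_finite[OF \<open>finite S\<close>])
qed

text \<open>Under \<open>step\<close> the exponential of the partial sums is a supermartingale, so
  this is Doob's maximal inequality localised to a history. The induction is on the number of
  remaining steps: the first increment moves into the threshold, the current state joins the
  history, and the time origin shifts by \<open>d\<close>. Hence the claim ranges over all histories
  and thresholds.\<close>

lemma grid_maximal_from_history:
  fixes X :: "real \<Rightarrow> 'a \<Rightarrow> 's" and \<xi> :: "'s \<Rightarrow> 's \<Rightarrow> real"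
  assumes fin: "finite S"
    and meas: "\<And>t. 0 \<le> t \<Longrightarrow> X t \<in> measurable M (count_space S)"
    and markov: "\<And>J \<sigma> t h s s'. finite J \<Longrightarrow> J \<subseteq> {0..t} \<Longrightarrow> 0 \<le> t \<Longrightarrow> 0 \<le> h \<Longrightarrow> s \<in> S \<Longrightarrow> s' \<in> S \<Longrightarrow>
      prob {\<omega> \<in> space M. X t \<omega> = s \<and> (\<forall>u\<in>J. X u \<omega> = \<sigma> u)} > 0 \<Longrightarrow>
      cond_prob M (\<lambda>\<omega>. X (t + h) \<omega> = s') (\<lambda>\<omega>. X t \<omega> = s \<and> (\<forall>u\<in>J. X u \<omega> = \<sigma> u)) = p h s s'"
    and d: "0 < d"
    and step: "\<And>s. s \<in> S \<Longrightarrow> (\<Sum>s'\<in>S. p d s s' * exp (\<xi> s s')) \<le> 1"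
  shows "finite J \<Longrightarrow> J \<subseteq> {0..<t} \<Longrightarrow> 0 \<le> t \<Longrightarrow> s \<in> S \<Longrightarrow>
    prob {\<omega> \<in> space M. (X t \<omega> = s \<and> (\<forall>u\<in>J. X u \<omega> = \<sigma> u)) \<and>
        (\<exists>k\<le>m. a \<le> (\<Sum>l<k. \<xi> (X (t + real l * d) \<omega>) (X (t + real (Suc l) * d) \<omega>)))}
      \<le> prob {\<omega> \<in> space M. X t \<omega> = s \<and> (\<forall>u\<in>J. X u \<omega> = \<sigma> u)} * exp (- a)"
proof (induction m arbitrary: J \<sigma> t s a)
  let ?H = "\<lambda>t J s \<sigma>. {\<omega> \<in> space M. X t \<omega> = s \<and> (\<forall>u\<in>J. X u \<omega> = \<sigma> u)}"
  let ?Z = "\<lambda>t k \<omega>. \<Sum>l<k. \<xi> (X (t + real l * d) \<omega>) (X (t + real (Suc l) * d) \<omega>)"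
  let ?E = "\<lambda>t J s \<sigma> m a. {\<omega> \<in> space M. (X t \<omega> = s \<and> (\<forall>u\<in>J. X u \<omega> = \<sigma> u)) \<and> (\<exists>k\<le>m. a \<le> ?Z t k \<omega>)}"
  have [measurable]: "Measurable.pred M (\<lambda>\<omega>. X u \<omega> = c)" if "0 \<le> u" for u c
    using pred_eq_process[OF meas[OF that]] .
  have H_sets: "?H t J s \<sigma> \<in> events" if "finite J" "J \<subseteq> {0..<t}" "0 \<le> t" for t J s \<sigma>
  proof -
    have "Measurable.pred M (\<lambda>\<omega>. X u \<omega> = \<sigma> u)" if "u \<in> J" for u
      using that \<open>J \<subseteq> {0..<t}\<close> by (intro pred_eq_process[OF meas]) auto
    then have "Measurable.pred M (\<lambda>\<omega>. X t \<omega> = s \<and> (\<forall>u\<in>J. X u \<omega> = \<sigma> u))"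
      using that by (intro pred_intros_logic pred_intros_finite) auto
    then show ?thesis by (simp add: pred_def)
  qed
  have E_sets: "?E t J s \<sigma> m a \<in> events" if "finite J" "J \<subseteq> {0..<t}" "0 \<le> t" for t J s \<sigma> m a
  proof -
    have [measurable]: "?Z t k \<in> borel_measurable M" for k
      using that d by (intro grid_sum_measurable[OF fin meas]) auto
    have "{\<omega> \<in> space M. \<exists>k\<le>m. a \<le> ?Z t k \<omega>} \<in> events"
      by measurable
    then have "?H t J s \<sigma> \<inter> {\<omega> \<in> space M. \<exists>k\<le>m. a \<le> ?Z t k \<omega>} \<in> events"
      using H_sets[OF that] by blast
    also have "?H t J s \<sigma> \<inter> {\<omega> \<in> space M. \<exists>k\<le>m. a \<le> ?Z t k \<omega>} = ?E t J s \<sigma> m a" by blast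
    finally show ?thesis .
  qed
  \<comment> \<open>For \<open>a \<le> 0\<close> the factor \<open>exp (- a)\<close> is at least 1.
    This covers \<open>k = 0\<close>, where the empty sum is 0; for \<open>a > 0\<close> every
    witness \<open>k\<close> is positive and has a first increment to split off.\<close>
  have triv: "prob (?E t J s \<sigma> m a) \<le> prob (?H t J s \<sigma>) * exp (- a)"
    if "finite J" "J \<subseteq> {0..<t}" "0 \<le> t" "a \<le> 0" for t J s \<sigma> m a
  proof -
    have "prob (?E t J s \<sigma> m a) \<le> prob (?H t J s \<sigma>)"
      using H_sets that by (intro finite_measure_mono) auto
    also have "\<dots> \<le> prob (?H t J s \<sigma>) * exp (- a)"
      using \<open>a \<le> 0\<close> by (intro mult_left_le_one_le[THEN order_trans] mult_le_cancel_left1[THEN iffD2]) auto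
    finally show ?thesis .
  qed
  {
    case 0
    show ?case
    proof (cases "a \<le> 0")
      case True then show ?thesis using triv[of J t a s \<sigma> 0] 0 by simp
    next
      case False then show ?thesis by simp
    qed
  next
    case (Suc m)
    show ?case
    proof (cases "a \<le> 0 \<or> prob (?H t J s \<sigma>) = 0")
      case True
      then show ?thesis
      proof
        assume "a \<le> 0" then show ?thesis using triv[of J t a s \<sigma> "Suc m"] Suc.prems by simp
      next
        assume *: "prob (?H t J s \<sigma>) = 0"
        have "prob (?E t J s \<sigma> (Suc m) a) \<le> prob (?H t J s \<sigma>)"
          using H_sets Suc.prems by (intro finite_measure_mono) auto
        with * show ?thesis by simp
      qed
    next
      case False
      then have a: "a > 0" and pos: "prob (?H t J s \<sigma>) > 0"
        using measure_nonneg[of M "?H t J s \<sigma>"] by (auto simp: less_le)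
      \<comment> \<open>\<open>J\<close> lies strictly before \<open>t\<close>, so overwriting
        \<open>\<sigma>\<close> at \<open>t\<close> records the present state without altering the
        older constraints.\<close>
      let ?J = "insert t J" and ?\<sigma> = "\<sigma>(t := s)"
      have J: "finite ?J" "?J \<subseteq> {0..<t + d}" "0 \<le> t + d"
        using Suc.prems d by auto
      have tJ: "t \<notin> J" using Suc.prems by auto
      have H': "?H (t + d) ?J s' ?\<sigma> = {\<omega> \<in> space M. X (t + d) \<omega> = s' \<and> (X t \<omega> = s \<and> (\<forall>u\<in>J. X u \<omega> = \<sigma> u))}" for s'
        using tJ by auto
      \<comment> \<open>The Markov property enters here: the probability of a history extended by
        one step factorises through \<open>p d\<close>.\<close>
      have H_prob: "prob (?H (t + d) ?J s' ?\<sigma>) = prob (?H t J s \<sigma>) * p d s s'" if "s' \<in> S" for s'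
        using markov[of J t d s s' \<sigma>] Suc.prems that d pos unfolding H'
        by (force simp: cond_prob_def field_simps)
      have Zeq: "?Z t (Suc k) \<omega> = \<xi> (X t \<omega>) (X (t + d) \<omega>) + ?Z (t + d) k \<omega>" for k \<omega>
        by (subst sum.lessThan_Suc_shift) (simp add: algebra_simps)
      have "?E t J s \<sigma> (Suc m) a \<subseteq> (\<Union>s'\<in>S. ?E (t + d) ?J s' ?\<sigma> m (a - \<xi> s s'))"
      proof
        fix \<omega> assume w: "\<omega> \<in> ?E t J s \<sigma> (Suc m) a"
        then obtain k where k: "k \<le> Suc m" "a \<le> ?Z t k \<omega>" by blast
        with a obtain k' where k': "k = Suc k'" by (cases k) auto
        have "X (t + d) \<omega> \<in> S"
          using meas[of "t + d"] J w by (auto dest: measurable_space)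
        moreover have "a - \<xi> s (X (t + d) \<omega>) \<le> ?Z (t + d) k' \<omega>"
          using k w unfolding k' Zeq by auto
        ultimately show "\<omega> \<in> (\<Union>s'\<in>S. ?E (t + d) ?J s' ?\<sigma> m (a - \<xi> s s'))"
          using w k k' tJ by auto
      qed
      then have "prob (?E t J s \<sigma> (Suc m) a) \<le> prob (\<Union>s'\<in>S. ?E (t + d) ?J s' ?\<sigma> m (a - \<xi> s s'))"
        using fin by (intro finite_measure_mono sets.finite_UN) (assumption | rule E_sets[OF J])+
      also have "\<dots> \<le> (\<Sum>s'\<in>S. prob (?E (t + d) ?J s' ?\<sigma> m (a - \<xi> s s')))"
        using fin by (intro finite_measure_subadditive_finite image_subsetI) (assumption | rule E_sets[OF J])+
      also have "\<dots> \<le> (\<Sum>s'\<in>S. prob (?H (t + d) ?J s' ?\<sigma>) * exp (- (a - \<xi> s s')))"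
        by (rule sum_mono, rule Suc.IH) (use J in auto)
      also have "\<dots> = prob (?H t J s \<sigma>) * exp (- a) * (\<Sum>s'\<in>S. p d s s' * exp (\<xi> s s'))"
        unfolding sum_distrib_left
      proof (rule sum.cong[OF refl])
        fix s' assume "s' \<in> S"
        have "exp (- (a - \<xi> s s')) = exp (- a) * exp (\<xi> s s')"
          by (simp add: exp_add[symmetric])
        then show "prob (?H (t + d) ?J s' ?\<sigma>) * exp (- (a - \<xi> s s')) =
            prob (?H t J s \<sigma>) * exp (- a) * (p d s s' * exp (\<xi> s s'))"
          by (simp only: H_prob[OF \<open>s' \<in> S\<close>] mult_ac)
      qed
      also have "\<dots> \<le> prob (?H t J s \<sigma>) * exp (- a) * 1"
        using step[OF \<open>s \<in> S\<close>] by (intro mult_left_mono) auto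
      finally show ?thesis by simp
    qed
  }
qed

end

text \<open>The row sums are 1, while \<open>sum\<close> over an infinite set is 0. Finiteness of
  the state space is thus read off from the chain itself.\<close>

lemma transition_function_finite:
  assumes "transition_function S p" shows "finite S"
proof (cases "S = {}")
  case False
  then obtain s where "(\<Sum>s'\<in>S. p 0 s s') = 1"
    using assms by (auto simp: transition_function_def)
  then show ?thesis using sum.infinite by fastforce
qed simp

lemma markov_chain_finite_states: "markov_chain M S q X \<Longrightarrow> finite S"
  unfolding markov_chain_def by (elim conjE exE) (rule transition_function_finite)

text \<open>Because \<open>\<psi> s = 0\<close>, the diagonal entry drops out of the moment minus 1,
  whose right derivative at 0 is then the rate sum in \<open>less\<close>. The strict inequality
  there yields a bound for all small \<open>t\<close>.\<close>

lemma exp_moment_small_time: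
  fixes p :: "real \<Rightarrow> 's \<Rightarrow> 's \<Rightarrow> real" and \<psi> :: "'s \<Rightarrow> real"
  assumes tf: "transition_function S p" and rates: "has_jump_rates S p q" and s: "s \<in> S"
    and \<psi>: "\<psi> s = 0" and less: "(\<Sum>s'\<in>S - {s}. q s s' * (exp (\<psi> s') - 1)) < b"
  shows "\<forall>\<^sub>F t in at_right 0. (\<Sum>s'\<in>S. p t s s' * exp (\<psi> s' - b * t)) \<le> 1"
proof -
  have sum1: "(\<Sum>s'\<in>S. p t s s') = 1" if "0 \<le> t" for t
    using tf s that by (auto simp: transition_function_def)
  have fin: "finite S" using tf by (rule transition_function_finite)
  define g where "g t = (\<Sum>s'\<in>S - {s}. p t s s' * (exp (\<psi> s') - 1))" for t
  have "(g has_real_derivative (\<Sum>s'\<in>S - {s}. q s s' * (exp (\<psi> s') - 1))) (at 0 within {0..})"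
    unfolding g_def using rates s
    by (intro DERIV_sum DERIV_cmult_right) (auto simp: has_jump_rates_def)
  then have "((\<lambda>t. (g t - g 0) / (t - 0)) \<longlongrightarrow> (\<Sum>s'\<in>S - {s}. q s s' * (exp (\<psi> s') - 1))) (at 0 within {0..})"
    by (simp add: has_field_derivative_iff)
  moreover have "at_right 0 \<le> at (0::real) within {0..}"
    by (intro at_le) auto
  ultimately have "((\<lambda>t. (g t - g 0) / (t - 0)) \<longlongrightarrow> (\<Sum>s'\<in>S - {s}. q s s' * (exp (\<psi> s') - 1))) (at_right 0)"
    using tendsto_mono by blast
  from order_tendstoD(2)[OF this less] eventually_at_right_less[of "0::real"]
  show ?thesis
  proof eventually_elim
    case (elim t)
    have "g 0 = 0"
      unfolding g_def using tf s by (intro sum.neutral) (auto simp: transition_function_def)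
    with elim have gt: "g t < b * t" by (simp add: field_simps)
    have "(\<Sum>s'\<in>S. p t s s' * exp (\<psi> s')) = (\<Sum>s'\<in>S. p t s s' * (exp (\<psi> s') - 1)) + (\<Sum>s'\<in>S. p t s s')"
      by (simp add: sum.distrib[symmetric] algebra_simps)
    also have "\<dots> = g t + 1"
      using fin s \<psi> sum1[of t] elim by (simp add: g_def sum.remove[of S s])
    \<comment> \<open>The linear bound is made exponential by
      \<open>1 + b * t \<le> exp (b * t)\<close>, the form that multiplies along a grid.\<close>
    also have "\<dots> \<le> exp (b * t)"
      using gt exp_ge_add_one_self[of "b * t"] by linarith
    finally have "(\<Sum>s'\<in>S. p t s s' * exp (\<psi> s')) * exp (- (b * t)) \<le> exp (b * t) * exp (- (b * t))"
      by (intro mult_right_mono) auto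
    then show ?case
      by (simp add: exp_diff exp_minus sum_divide_distrib divide_simps)
  qed
qed

text \<open>With increments \<open>f s' - f s - b s * d\<close> the partial sums telescope. Letting
  \<open>b\<close> depend on the state allows it to contain the drift.\<close>

lemma (in prob_space) markov_chain_grid_maximal:
  fixes f :: "'s \<Rightarrow> real"
  assumes chain: "markov_chain M S q X"
    and less: "\<And>s. s \<in> S \<Longrightarrow> (\<Sum>s'\<in>S - {s}. q s s' * (exp (f s' - f s) - 1)) < b s"
  shows "\<forall>\<^sub>F d in at_right 0. \<forall>m a.
    prob {\<omega> \<in> space M. \<exists>k\<le>m. a \<le> f (X (real k * d) \<omega>) - f (X 0 \<omega>) - d * (\<Sum>l<k. b (X (real l * d) \<omega>))} \<le> exp (- a)"
proof -
  obtain p where tf: "transition_function S p" and rates: "has_jump_rates S p q" and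
    markov: "\<forall>J \<sigma> t h s s'. finite J \<and> J \<subseteq> {0..t} \<and> 0 \<le> t \<and> 0 \<le> h \<and> s \<in> S \<and> s' \<in> S \<and>
      prob {\<omega> \<in> space M. X t \<omega> = s \<and> (\<forall>u\<in>J. X u \<omega> = \<sigma> u)} > 0 \<longrightarrow>
      cond_prob M (\<lambda>\<omega>. X (t + h) \<omega> = s') (\<lambda>\<omega>. X t \<omega> = s \<and> (\<forall>u\<in>J. X u \<omega> = \<sigma> u)) = p h s s'"
    using chain unfolding markov_chain_def by (elim conjE exE)
  have meas: "\<And>t. 0 \<le> t \<Longrightarrow> X t \<in> measurable M (count_space S)"
    using chain by (auto simp: markov_chain_def)
  have fin: "finite S" using tf by (rule transition_function_finite)
  \<comment> \<open>Finiteness of \<open>S\<close> gives one mesh threshold for all states,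
    independent of \<open>m\<close> and \<open>a\<close>.\<close>
  have "\<forall>\<^sub>F d in at_right 0. \<forall>s\<in>S. (\<Sum>s'\<in>S. p d s s' * exp (f s' - f s - b s * d)) \<le> 1"
    using fin less by (intro eventually_ball_finite ballI exp_moment_small_time[OF tf rates]) auto
  with eventually_at_right_less[of "0::real"] show ?thesis
  proof eventually_elim
    case (elim d)
    show ?case
    proof (intro allI)
      fix m a
      define Z where "Z k \<omega> = (\<Sum>l<k. (f (X (0 + real (Suc l) * d) \<omega>) - f (X (0 + real l * d) \<omega>)
          - b (X (0 + real l * d) \<omega>) * d))" for k \<omega>
      let ?E = "\<lambda>s. {\<omega> \<in> space M. X 0 \<omega> = s \<and> (\<exists>k\<le>m. a \<le> Z k \<omega>)}"
      have Z: "Z k \<omega> = f (X (real k * d) \<omega>) - f (X 0 \<omega>) - d * (\<Sum>l<k. b (X (real l * d) \<omega>))" for k \<omega>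
        unfolding Z_def by (induction k) (simp_all add: algebra_simps)
      \<comment> \<open>The empty history imposes no condition, so any \<open>\<sigma>\<close> will
        do.\<close>
      have bound: "prob (?E s) \<le> prob {\<omega> \<in> space M. X 0 \<omega> = s} * exp (- a)" if "s \<in> S" for s
        using grid_maximal_from_history[OF fin meas markov[rule_format, OF conjI[OF _ conjI[OF _ conjI[OF _ conjI[OF _ conjI[OF _ conjI]]]]]],
          where d=d and \<xi>="\<lambda>s s'. f s' - f s - b s * d" and J="{}" and t=0 and s=s and \<sigma>=undefined and a=a and m=m]
          elim that unfolding Z_def by simp
      have X0: "{\<omega> \<in> space M. X 0 \<omega> = s} \<in> events" for s
        using pred_eq_process[OF meas[of 0], of s] by (simp add: pred_def)
      have E_sets: "?E s \<in> events" for s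
      proof -
        have [measurable]: "Z k \<in> borel_measurable M" for k
          using grid_sum_measurable[OF fin meas, where \<xi>="\<lambda>s s'. f s' - f s - b s * d" and t=0 and d=d and k=k]
            elim unfolding Z_def by simp
        have "{\<omega> \<in> space M. \<exists>k\<le>m. a \<le> Z k \<omega>} \<in> events" by measurable
        then have "{\<omega> \<in> space M. X 0 \<omega> = s} \<inter> {\<omega> \<in> space M. \<exists>k\<le>m. a \<le> Z k \<omega>} \<in> events"
          using X0 by blast
        also have "{\<omega> \<in> space M. X 0 \<omega> = s} \<inter> {\<omega> \<in> space M. \<exists>k\<le>m. a \<le> Z k \<omega>} = ?E s" by blast
        finally show ?thesis .
      qed
      have "{\<omega> \<in> space M. \<exists>k\<le>m. a \<le> f (X (real k * d) \<omega>) - f (X 0 \<omega>) - d * (\<Sum>l<k. b (X (real l * d) \<omega>))}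
          = (\<Union>s\<in>S. ?E s)"
        using measurable_space[OF meas[of 0]] by (auto simp: Z)
      also have "prob \<dots> \<le> (\<Sum>s\<in>S. prob (?E s))"
        using fin E_sets by (intro finite_measure_subadditive_finite image_subsetI)
      also have "\<dots> \<le> (\<Sum>s\<in>S. prob {\<omega> \<in> space M. X 0 \<omega> = s} * exp (- a))"
        by (intro sum_mono bound)
      also have "\<dots> = prob (\<Union>s\<in>S. {\<omega> \<in> space M. X 0 \<omega> = s}) * exp (- a)"
        unfolding sum_distrib_right[symmetric]
        by (subst finite_measure_finite_Union) (use fin X0 in \<open>auto simp: disjoint_family_on_def\<close>)
      also have "\<dots> \<le> exp (- a)" by simp
      finally show "prob {\<omega> \<in> space M. \<exists>k\<le>m. a \<le> f (X (real k * d) \<omega>) - f (X 0 \<omega>) - d * (\<Sum>l<k. b (X (real l * d) \<omega>))}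
          \<le> exp (- a)" .
    qed
  qed
qed

section \<open>Generator estimate for the walkers\<close>

text \<open>The logarithmic moment generating function of a centred Poisson variable of intensity 1.
  Its convex conjugate at positive arguments is \<open>h_fun\<close>.\<close>

definition phi_fun :: "real \<Rightarrow> real" where
  "phi_fun x = exp x - 1 - x"

lemma phi_fun_nonneg: "0 \<le> phi_fun x"
  using exp_ge_add_one_self[of x] by (simp add: phi_fun_def algebra_simps)

text \<open>For \<open>x < 0\<close> the difference of the two sides is
  \<open>2 * (sinh y - y)\<close> at \<open>y = - x\<close>. One constant thus serves both signs of
  the exponential parameter.\<close>

lemma phi_fun_le_abs: "phi_fun x \<le> phi_fun \<bar>x\<bar>"
proof (cases "0 \<le> x")
  case False
  define g where "g y = exp y - exp (- y) - 2 * y" for y :: real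
  have "g 0 \<le> g (- x)"
  proof (rule DERIV_nonneg_imp_nondecreasing[of 0 "-x"])
    fix y :: real
    have "2 \<le> exp y + exp (- y)"
      using exp_ge_add_one_self[of "y"] exp_ge_add_one_self[of "-y"] by linarith
    then have "0 \<le> exp y + exp (- y) - 2" by simp
    moreover have "(g has_real_derivative exp y + exp (- y) - 2) (at y)"
      unfolding g_def by (auto intro!: derivative_eq_intros)
    ultimately show "\<exists>D. (g has_real_derivative D) (at y) \<and> 0 \<le> D" by blast
  qed (use False in auto)
  with False show ?thesis by (simp add: g_def phi_fun_def)
qed simp

text \<open>\<open>v\<close> stands for a coordinate of a jump, scaled by \<open>n\<close>. Summed
  against the rates, the linear term becomes the drift and the remainder counts the jumps that move
  the coordinate.\<close>

lemma exp_minus_one_le_sign: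
  fixes v :: real
  assumes "v \<in> {-1, 0, 1}"
  shows "exp (\<theta> * v) - 1 \<le> \<theta> * v + phi_fun \<bar>\<theta>\<bar> * \<bar>v\<bar>"
  using assms phi_fun_le_abs[of \<theta>] phi_fun_le_abs[of "-\<theta>"] by (auto simp: phi_fun_def)

lemma rate_mat_offdiag:
  "i \<noteq> j \<Longrightarrow> rate_mat E $ i $ j = (if (i, j) \<in> E then 1 else 0)"
  by (simp add: rate_mat_def laplacian_def degree_mat_def diag_mat_def adj_mat_def)

lemma rate_mat_diag:
  assumes "irrefl E"
  shows "rate_mat E $ i $ i = - (\<Sum>j\<in>UNIV - {i}. rate_mat E $ i $ j)"
proof -
  have "(\<Sum>j\<in>UNIV - {i}. rate_mat E $ i $ j) = (\<Sum>j\<in>UNIV - {i}. if (i, j) \<in> E then 1 else 0)"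
    by (intro sum.cong) (auto simp: rate_mat_offdiag)
  also have "\<dots> = real (card {j. (i, j) \<in> E})"
    using assms by (auto simp: sum.If_cases irrefl_def intro!: arg_cong[where f=card])
  finally show ?thesis
    using assms by (simp add: rate_mat_def laplacian_def degree_mat_def diag_mat_def adj_mat_def irrefl_def)
qed

definition drift :: "('v::finite \<times> 'v) set \<Rightarrow> real \<Rightarrow> real ^ 'v \<Rightarrow> real ^ 'v \<Rightarrow> real ^ 'v" where
  "drift E \<kappa> x y = fst (vector_field E \<kappa> (x, y))"

lemma vector_field_eq_drift: "vector_field E \<kappa> (x, y) = (drift E \<kappa> x y, drift E \<kappa> y x)"
  by (simp add: drift_def vector_field_def inner_commute)

lemma drift_nth:
  "drift E \<kappa> x y $ k =
     (\<Sum>j\<in>UNIV. rate_mat E $ j $ k * x $ j) + \<kappa> * (x \<bullet> y) * x $ k - \<kappa> * y $ k * x $ k"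
  by (simp add: drift_def vector_field_def matrix_vector_mult_def transpose_def diag_mat_def
      if_distrib if_distribR sum.delta cong: if_cong)

lemma rate_y_eq_rate_x: "rate_y E \<kappa> n j i (x, y) = rate_x E \<kappa> n j i (y, x)"
  by (simp add: rate_x_def rate_y_def mult_ac)

lemma inner_one: "x \<bullet> (1 :: real ^ 'v::finite) = (\<Sum>i\<in>UNIV. x $ i)"
  by (simp add: inner_vec_def)

lemma simplex_set_iff: "x \<in> simplex_set \<longleftrightarrow> (\<Sum>i\<in>UNIV. x $ i) = 1 \<and> (\<forall>i. 0 \<le> x $ i)"
  by (auto simp: simplex_set_def inner_one less_eq_vec_def)

lemma simplex_set_nth_le_1: "x \<in> simplex_set \<Longrightarrow> x $ i \<le> 1"
  using member_le_sum[of i UNIV "\<lambda>i. x $ i"] by (simp add: simplex_set_iff)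

lemma simplex_set_pair_le_1: "x \<in> simplex_set \<Longrightarrow> i \<noteq> j \<Longrightarrow> x $ i + x $ j \<le> 1"
  using sum_mono2[of UNIV "{i, j}" "\<lambda>i. x $ i"] by (simp add: simplex_set_iff)

lemma rate_x_nonneg:
  assumes "x \<in> simplex_set" "y \<in> simplex_set" "0 \<le> \<kappa>" "i \<noteq> j"
  shows "0 \<le> rate_x E \<kappa> n j i (x, y)"
  using assms by (auto simp: rate_x_def rate_mat_offdiag simplex_set_iff intro!: mult_nonneg_nonneg add_nonneg_nonneg)

text \<open>The two opposite flows are bounded together: \<open>x $ i + x $ j \<le> 1\<close>
  controls both linear terms at once, and likewise for \<open>y\<close> in the interaction. Bounding
  each flow by \<open>real n * (1 + \<kappa>)\<close> would double the constant.\<close>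

lemma rate_x_pair_le:
  assumes x: "x \<in> simplex_set" and y: "y \<in> simplex_set" and "0 \<le> \<kappa>" "i \<noteq> j"
  shows "rate_x E \<kappa> n j i (x, y) + rate_x E \<kappa> n i j (x, y) \<le> real n * (1 + \<kappa>)"
proof -
  have nn: "0 \<le> x $ l" "0 \<le> y $ l" for l using x y by (auto simp: simplex_set_iff)
  have "rate_mat E $ j $ i * x $ j \<le> 1 * x $ j" "rate_mat E $ i $ j * x $ i \<le> 1 * x $ i"
    using nn \<open>i \<noteq> j\<close> by (auto simp: rate_mat_offdiag)
  then have 1: "rate_mat E $ j $ i * x $ j + rate_mat E $ i $ j * x $ i \<le> 1"
    using simplex_set_pair_le_1[OF x \<open>i \<noteq> j\<close>] by simp
  have "(x $ i * x $ j) * (y $ i + y $ j) \<le> 1 * 1"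
    using simplex_set_pair_le_1[OF y \<open>i \<noteq> j\<close>] simplex_set_nth_le_1[OF x] nn
    by (intro mult_mono mult_le_one) auto
  then have "\<kappa> * ((x $ i * x $ j) * (y $ i + y $ j)) \<le> \<kappa> * 1"
    using \<open>0 \<le> \<kappa>\<close> by (intro mult_left_mono) auto
  with 1 have "real n * ((rate_mat E $ j $ i * x $ j + rate_mat E $ i $ j * x $ i) +
      \<kappa> * ((x $ i * x $ j) * (y $ i + y $ j))) \<le> real n * (1 + \<kappa>)"
    by (intro mult_left_mono) auto
  then show ?thesis by (simp add: rate_x_def algebra_simps)
qed

text \<open>Moves that neither enter nor leave \<open>k\<close> contribute
  \<open>\<alpha> 0\<close>. Grouping the others into opposite pairs prepares the use of
  \<open>rate_x_pair_le\<close>.\<close>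

lemma sum_flow_through_node:
  fixes r :: "'v::finite \<Rightarrow> 'v \<Rightarrow> real" and \<alpha> :: "real \<Rightarrow> real"
  assumes "\<alpha> 0 = 0"
  shows "(\<Sum>j\<in>UNIV. \<Sum>i\<in>UNIV - {j}. r j i * \<alpha> ((axis i 1 - axis j 1 :: real ^ 'v) $ k))
    = (\<Sum>j\<in>UNIV - {k}. r j k * \<alpha> 1 + r k j * \<alpha> (- 1))"
proof -
  have 1: "(\<Sum>i\<in>UNIV - {j}. r j i * \<alpha> ((axis i 1 - axis j 1 :: real ^ 'v) $ k)) = r j k * \<alpha> 1"
    if "j \<noteq> k" for j
  proof -
    have "(\<Sum>i\<in>UNIV - {j}. r j i * \<alpha> ((axis i 1 - axis j 1 :: real ^ 'v) $ k)) =
        (\<Sum>i\<in>{k}. r j i * \<alpha> ((axis i 1 - axis j 1 :: real ^ 'v) $ k))"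
      using that assms by (intro sum.mono_neutral_right) (auto simp: axis_def)
    then show ?thesis using that by (simp add: axis_def)
  qed
  have 2: "(\<Sum>i\<in>UNIV - {k}. r k i * \<alpha> ((axis i 1 - axis k 1 :: real ^ 'v) $ k)) = (\<Sum>i\<in>UNIV - {k}. r k i * \<alpha> (- 1))"
    by (intro sum.cong) (auto simp: axis_def)
  show ?thesis
    by (simp add: sum.remove[of UNIV k] 1 2 sum.distrib del: vector_minus_component)
qed

text \<open>The left side is the net flow into \<open>k\<close>. Zero row sums supply the diagonal
  rate, and unit mass turns the outgoing interaction into a factor \<open>1 - x $ k\<close>, whose
  second part is the missing term \<open>j = k\<close> of \<open>x \<bullet> y\<close>.\<close>

lemma sum_rate_x_drift:
  assumes "irrefl E" "x \<in> simplex_set"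
  shows "(\<Sum>j\<in>UNIV - {k}. rate_x E \<kappa> n j k (x, y) - rate_x E \<kappa> n k j (x, y)) = real n * drift E \<kappa> x y $ k"
proof -
  let ?Q = "rate_mat E"
  have s1: "(\<Sum>j\<in>UNIV - {k}. x $ j) = 1 - x $ k"
    using assms by (simp add: simplex_set_iff sum.remove[of UNIV k])
  have "(\<Sum>j\<in>UNIV - {k}. rate_x E \<kappa> n j k (x, y) - rate_x E \<kappa> n k j (x, y)) =
    real n * ((\<Sum>j\<in>UNIV - {k}. ?Q $ j $ k * x $ j) - (\<Sum>j\<in>UNIV - {k}. ?Q $ k $ j) * x $ k
      + \<kappa> * (\<Sum>j\<in>UNIV - {k}. x $ j * y $ j) * x $ k - \<kappa> * x $ k * y $ k * (\<Sum>j\<in>UNIV - {k}. x $ j))"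
    by (simp add: rate_x_def sum_distrib_left sum_distrib_right sum_subtractf[symmetric] sum.distrib[symmetric] algebra_simps)
  also have "\<dots> = real n * ((\<Sum>j\<in>UNIV - {k}. ?Q $ j $ k * x $ j) + ?Q $ k $ k * x $ k
      + \<kappa> * (\<Sum>j\<in>UNIV - {k}. x $ j * y $ j) * x $ k - \<kappa> * x $ k * y $ k * (1 - x $ k))"
    by (simp add: rate_mat_diag[OF assms(1)] s1)
  also have "\<dots> = real n * drift E \<kappa> x y $ k"
    by (simp add: drift_nth inner_vec_def sum.remove[of UNIV k] algebra_simps)
  finally show ?thesis .
qed

lemma sum_rate_x_exp_le:
  fixes E :: "('v::finite \<times> 'v) set"
  assumes "irrefl E" and x: "x \<in> simplex_set" and y: "y \<in> simplex_set" and "0 \<le> \<kappa>"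
  shows "(\<Sum>j\<in>UNIV. \<Sum>i\<in>UNIV - {j}. rate_x E \<kappa> n j i (x, y) * (exp (\<theta> * (axis i 1 - axis j 1 :: real ^ 'v) $ k) - 1))
    \<le> \<theta> * real n * drift E \<kappa> x y $ k + real n * (real CARD('v) - 1) * (1 + \<kappa>) * phi_fun \<bar>\<theta>\<bar>"
    (is "?L \<le> _")
proof -
  let ?r = "\<lambda>j i. rate_x E \<kappa> n j i (x, y)"
  have v: "(axis i 1 - axis j 1 :: real ^ 'v) $ k \<in> {-1, 0, 1}" for i j
    by (simp add: axis_def)
  have "?L \<le> (\<Sum>j\<in>UNIV. \<Sum>i\<in>UNIV - {j}. ?r j i * (\<theta> * (axis i 1 - axis j 1 :: real ^ 'v) $ k
      + phi_fun \<bar>\<theta>\<bar> * \<bar>(axis i 1 - axis j 1 :: real ^ 'v) $ k\<bar>))"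
    using assms by (intro sum_mono mult_left_mono exp_minus_one_le_sign v rate_x_nonneg) auto
  also have "\<dots> = (\<Sum>j\<in>UNIV - {k}. ?r j k * (\<theta> + phi_fun \<bar>\<theta>\<bar>) + ?r k j * (- \<theta> + phi_fun \<bar>\<theta>\<bar>))"
    by (subst sum_flow_through_node[where \<alpha>="\<lambda>u. \<theta> * u + phi_fun \<bar>\<theta>\<bar> * \<bar>u\<bar>"]) auto
  also have "\<dots> = \<theta> * (\<Sum>j\<in>UNIV - {k}. ?r j k - ?r k j) + phi_fun \<bar>\<theta>\<bar> * (\<Sum>j\<in>UNIV - {k}. ?r j k + ?r k j)"
    by (simp add: sum_distrib_left sum.distrib[symmetric] algebra_simps)
  also have "\<dots> \<le> \<theta> * (real n * drift E \<kappa> x y $ k) + phi_fun \<bar>\<theta>\<bar> * (\<Sum>j\<in>UNIV - {k}. real n * (1 + \<kappa>))"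
    unfolding sum_rate_x_drift[OF \<open>irrefl E\<close> x]
    using assms by (intro add_left_mono mult_left_mono sum_mono rate_x_pair_le phi_fun_nonneg) auto
  also have "(\<Sum>j\<in>UNIV - {k}. real n * (1 + \<kappa>)) = (real CARD('v) - 1) * (real n * (1 + \<kappa>))"
    by (simp add: of_nat_diff card_Diff_singleton)
  finally show ?thesis by (simp add: mult_ac)
qed

text \<open>A nonzero coordinate of a lattice point is at least \<open>1 / n\<close>, so a walker
  can be removed there.\<close>

lemma lattice_simplex_move:
  fixes x :: "real ^ 'v::finite"
  assumes x: "x \<in> lattice_simplex n" and n: "n \<ge> 1" and "i \<noteq> j" "x $ j \<noteq> 0"
  shows "x + (1 / real n) *\<^sub>R (axis i 1 - axis j 1) \<in> lattice_simplex n"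
proof -
  obtain u where u: "x = (1 / real n) *\<^sub>R u" "\<And>l. u $ l \<in> \<int>" and xs: "x \<in> simplex_set"
    using x by (auto simp: lattice_simplex_def)
  let ?d = "axis i 1 - axis j 1 :: real ^ 'v"
  have nn: "0 \<le> x $ l" for l using xs by (simp add: simplex_set_iff)
  have "u $ j > 0" using nn[of j] \<open>x $ j \<noteq> 0\<close> n by (auto simp: u(1) less_le zero_le_divide_iff)
  then have uj: "u $ j \<ge> 1" using u(2)[of j] by (auto elim!: Ints_cases)
  have "u $ l + ?d $ l \<in> \<int>" for l
    using u(2) by (auto simp: axis_def)
  moreover have eq: "x + (1 / real n) *\<^sub>R ?d = (1 / real n) *\<^sub>R (u + ?d)"
    by (simp add: u(1) scaleR_add_right)
  moreover have "x + (1 / real n) *\<^sub>R ?d \<in> simplex_set"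
    unfolding simplex_set_iff
  proof
    have "(\<Sum>l\<in>UNIV. ?d $ l) = 0"
      by (simp add: sum_subtractf axis_def)
    then have "(\<Sum>l\<in>UNIV. (1 / real n) * ?d $ l) = 0"
      by (simp only: sum_distrib_left[symmetric] mult_zero_right)
    then show "(\<Sum>l\<in>UNIV. (x + (1 / real n) *\<^sub>R ?d) $ l) = 1"
      using xs by (simp add: simplex_set_iff sum.distrib del: vector_minus_component)
    show "\<forall>l. 0 \<le> (x + (1 / real n) *\<^sub>R ?d) $ l"
    proof
      fix l
      have "0 \<le> u $ l + ?d $ l"
        using uj nn[of l] n by (cases "l = j") (auto simp: axis_def u(1) zero_le_divide_iff)
      then show "0 \<le> (x + (1 / real n) *\<^sub>R ?d) $ l"
        unfolding eq by simp
    qed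
  qed
  ultimately show ?thesis
    unfolding lattice_simplex_def by (auto intro!: exI[of _ "u + ?d"])
qed

text \<open>Passes from target states to moves. A move out of the state space would start from an
  empty node and has rate 0, and no move is null, so restricting the targets to
  \<open>state_space n - {s}\<close> loses no summand.\<close>

lemma sum_jump_rate:
  fixes E :: "('v::finite \<times> 'v) set"
  assumes fin: "finite (state_space n :: ((real ^ 'v) \<times> (real ^ 'v)) set)" and n: "n \<ge> 1"
    and s: "s \<in> state_space n"
  shows "(\<Sum>s'\<in>state_space n - {s}. jump_rate E \<kappa> n s s' * g s') =
    (\<Sum>j\<in>UNIV. \<Sum>i\<in>UNIV - {j}.
       rate_x E \<kappa> n j i s * g (s + ((1 / real n) *\<^sub>R (axis i 1 - axis j 1), 0)) +
       rate_y E \<kappa> n j i s * g (s + (0, (1 / real n) *\<^sub>R (axis i 1 - axis j 1))))"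
proof -
  let ?S = "state_space n :: ((real ^ 'v) \<times> (real ^ 'v)) set"
  let ?d = "\<lambda>i j. (1 / real n) *\<^sub>R (axis i 1 - axis j 1) :: real ^ 'v"
  obtain x y where xy: "s = (x, y)" "x \<in> lattice_simplex n" "y \<in> lattice_simplex n"
    using s by (auto simp: state_space_def)
  have d0: "?d i j \<noteq> 0" if "i \<noteq> j" for i j
  proof -
    have "(axis i 1 - axis j 1 :: real ^ 'v) $ i \<noteq> 0" using that by (simp add: axis_def)
    then show ?thesis using n by (auto simp del: vector_minus_component)
  qed
  have delta: "(\<Sum>s'\<in>?S - {s}. (if s' = s + v then r else 0) * g s') = r * g (s + v)"
    if "v \<noteq> 0" "r \<noteq> 0 \<Longrightarrow> s + v \<in> ?S" for v r
  proof -
    have "(\<Sum>s'\<in>?S - {s}. (if s' = s + v then r else 0) * g s') =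
        (\<Sum>s'\<in>?S - {s}. if s' = s + v then r * g (s + v) else 0)"
      by (intro sum.cong) auto
    with that fin show ?thesis by (auto simp: sum.delta)
  qed
  have rx: "(\<Sum>s'\<in>?S - {s}. (if s' = s + (?d i j, 0) then rate_x E \<kappa> n j i s else 0) * g s')
      = rate_x E \<kappa> n j i s * g (s + (?d i j, 0))" if "i \<noteq> j" for i j
  proof (rule delta)
    show "s + (?d i j, 0) \<in> ?S" if "rate_x E \<kappa> n j i s \<noteq> 0"
      using that xy lattice_simplex_move[OF xy(2) n \<open>i \<noteq> j\<close>]
      by (cases "x $ j = 0") (auto simp: rate_x_def state_space_def)
  qed (use d0[OF that] in \<open>simp add: zero_prod_def\<close>)
  have ry: "(\<Sum>s'\<in>?S - {s}. (if s' = s + (0, ?d i j) then rate_y E \<kappa> n j i s else 0) * g s')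
      = rate_y E \<kappa> n j i s * g (s + (0, ?d i j))" if "i \<noteq> j" for i j
  proof (rule delta)
    show "s + (0, ?d i j) \<in> ?S" if "rate_y E \<kappa> n j i s \<noteq> 0"
      using that xy lattice_simplex_move[OF xy(3) n \<open>i \<noteq> j\<close>]
      by (cases "y $ j = 0") (auto simp: rate_y_def state_space_def)
  qed (use d0[OF that] in \<open>simp add: zero_prod_def\<close>)
  have "(\<Sum>s'\<in>?S - {s}. jump_rate E \<kappa> n s s' * g s') =
    (\<Sum>j\<in>UNIV. \<Sum>i\<in>UNIV - {j}. \<Sum>s'\<in>?S - {s}.
        (if s' = s + (?d i j, 0) then rate_x E \<kappa> n j i s else 0) * g s' +
        (if s' = s + (0, ?d i j) then rate_y E \<kappa> n j i s else 0) * g s')"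
    unfolding jump_rate_def sum_distrib_right distrib_right
    by (subst sum.swap, rule sum.cong[OF refl], rule sum.swap)
  also have "\<dots> = (\<Sum>j\<in>UNIV. \<Sum>i\<in>UNIV - {j}.
       rate_x E \<kappa> n j i s * g (s + (?d i j, 0)) + rate_y E \<kappa> n j i s * g (s + (0, ?d i j)))"
    unfolding sum.distrib[of _ _ "?S - {s}"]
    by (intro sum.cong refl arg_cong2[where f="(+)"] rx ry) auto
  finally show ?thesis .
qed

text \<open>The factor \<open>real n\<close> in the exponent cancels the jump size
  \<open>1 / n\<close>. Moves of the other group leave \<open>s \<bullet> b\<close> unchanged and
  contribute \<open>exp 0 - 1\<close>.\<close>

lemma generator_exp_le:
  fixes E :: "('v::finite \<times> 'v) set"
  assumes fin: "finite (state_space n :: ((real ^ 'v) \<times> (real ^ 'v)) set)" and n: "n \<ge> 1"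
    and s: "s \<in> state_space n" and E: "irrefl E" and \<kappa>: "0 \<le> \<kappa>" and b: "b \<in> Basis"
  shows "(\<Sum>s'\<in>state_space n - {s}. jump_rate E \<kappa> n s s' *
      (exp (\<theta> * real n * (s' \<bullet> b) - \<theta> * real n * (s \<bullet> b)) - 1))
    \<le> \<theta> * real n * (vector_field E \<kappa> s \<bullet> b) + real n * (real CARD('v) - 1) * (1 + \<kappa>) * phi_fun \<bar>\<theta>\<bar>"
proof -
  obtain x y where xy: "s = (x, y)" "x \<in> simplex_set" "y \<in> simplex_set"
    using s by (auto simp: state_space_def lattice_simplex_def)
  have scale: "\<theta> * real n * (((s::(real ^ 'v) \<times> (real ^ 'v)) + (1 / real n) *\<^sub>R d) \<bullet> b) - \<theta> * real n * (s \<bullet> b) = \<theta> * (d \<bullet> b)" for d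
    using n by (simp add: inner_add_left algebra_simps)
  have scx: "\<theta> * real n * ((s + ((1 / real n) *\<^sub>R d, 0)) \<bullet> b) - \<theta> * real n * (s \<bullet> b) = \<theta> * ((d, 0) \<bullet> b)" for d :: "real ^ 'v"
    using scale[of "(d, 0)"] by simp
  have scy: "\<theta> * real n * ((s + (0, (1 / real n) *\<^sub>R d)) \<bullet> b) - \<theta> * real n * (s \<bullet> b) = \<theta> * ((0, d) \<bullet> b)" for d :: "real ^ 'v"
    using scale[of "(0, d)"] by simp
  from b obtain k where "b = (axis k 1, 0) \<or> b = (0, axis k 1)"
    by (auto simp: Basis_prod_def Basis_vec_def)
  then show ?thesis
  proof
    assume b: "b = (axis k 1, 0)"
    show ?thesis
      unfolding sum_jump_rate[OF fin n s] scx scy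
      using sum_rate_x_exp_le[OF E xy(2,3) \<kappa>, of n \<theta> k]
      by (simp add: b xy(1) vector_field_eq_drift inner_axis del: vector_minus_component)
  next
    assume b: "b = (0, axis k 1)"
    show ?thesis
      unfolding sum_jump_rate[OF fin n s] scx scy
      using sum_rate_x_exp_le[OF E xy(3,2) \<kappa>, of n \<theta> k]
      by (simp add: b xy(1) vector_field_eq_drift inner_axis rate_y_eq_rate_x del: vector_minus_component)
  qed
qed

section \<open>Invariance of the simplices under the differential equation\<close>

text \<open>Gronwall's argument: after multiplication by the integrating factor
  \<open>exp (- C * t)\<close> the function is nonincreasing.\<close>

lemma deriv_le_mult_imp_nonpos:
  fixes \<Phi> :: "real \<Rightarrow> real"
  assumes der: "\<And>t. 0 \<le> t \<Longrightarrow> (\<Phi> has_real_derivative \<Phi>' t) (at t within {0..})"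
    and le: "\<And>t. 0 \<le> t \<Longrightarrow> t \<le> T \<Longrightarrow> \<Phi>' t \<le> C * \<Phi> t" and "\<Phi> 0 \<le> 0" "0 \<le> T"
  shows "\<Phi> T \<le> 0"
proof (cases "T = 0")
  case False
  define g where "g t = \<Phi> t * exp (- C * t)" for t
  have dg: "(g has_real_derivative (\<Phi>' t - C * \<Phi> t) * exp (- C * t)) (at t within {0..})" if "0 \<le> t" for t
  proof -
    have "((\<lambda>t. exp (- C * t)) has_real_derivative - C * exp (- C * t)) (at t within {0..})"
      by (auto intro!: derivative_eq_intros)
    from DERIV_mult[OF der[OF that] this] show ?thesis
      unfolding g_def by (rule DERIV_cong) (simp add: algebra_simps)
  qed
  have "g T \<le> g 0"
  proof (rule DERIV_nonpos_imp_decreasing_open[where f=g and a=0 and b=T])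
    fix t assume t: "0 < t" "t < T"
    then have "(g has_real_derivative (\<Phi>' t - C * \<Phi> t) * exp (- C * t)) (at t)"
      using dg[of t] at_within_interior[of t "{0..}"] by simp
    moreover have "(\<Phi>' t - C * \<Phi> t) * exp (- C * t) \<le> 0"
      using le[of t] t by (intro mult_nonpos_nonneg) auto
    ultimately show "\<exists>D. (g has_real_derivative D) (at t) \<and> D \<le> 0" by blast
  next
    have "continuous_on {0..} g"
      using dg by (intro DERIV_continuous_on) auto
    then show "continuous_on {0..T} g" by (rule continuous_on_subset) auto
  qed (use False \<open>0 \<le> T\<close> in auto)
  also have "\<dots> \<le> 0" using \<open>\<Phi> 0 \<le> 0\<close> by (simp add: g_def)
  finally show ?thesis by (simp add: g_def mult_le_0_iff)
qed (use assms in simp)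

text \<open>Squaring removes the kink of the negative part at 0, so nonnegativity can be tracked by
  a differentiable functional.\<close>

lemma DERIV_min_zero_square: "((\<lambda>u. (min u 0)\<^sup>2) has_real_derivative 2 * min u 0) (at (u::real))"
proof -
  consider "u < 0" | "u = 0" | "0 < u" by linarith
  then show ?thesis
  proof cases
    case 1
    have "((\<lambda>u. u\<^sup>2) has_real_derivative 2 * min u 0) (at u)"
      using 1 by (auto intro!: derivative_eq_intros)
    then show ?thesis
      by (rule has_field_derivative_transform_within_open[where S="{..<0}"]) (use 1 in auto)
  next
    case 2
    have "((\<lambda>y. (min y 0)\<^sup>2 / y) \<longlongrightarrow> 0) (at (0::real))"
    proof (rule Lim_null_comparison)
      show "\<forall>\<^sub>F y in at 0. norm ((min y 0)\<^sup>2 / y) \<le> \<bar>y\<bar>"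
        by (rule always_eventually) (auto simp: min_def power2_eq_square)
      show "((\<lambda>y. \<bar>y::real\<bar>) \<longlongrightarrow> 0) (at 0)"
        by (rule tendsto_rabs_zero) (rule tendsto_ident_at)
    qed
    with 2 show ?thesis by (simp add: has_field_derivative_iff)
  next
    case 3
    have "((\<lambda>u. 0) has_real_derivative 2 * min u 0) (at u)"
      using 3 by (auto intro!: derivative_eq_intros)
    then show ?thesis
      by (rule has_field_derivative_transform_within_open[where S="{0<..}"]) (use 3 in auto)
  qed
qed

lemma rate_mat_row_sum: "irrefl E \<Longrightarrow> (\<Sum>k\<in>UNIV. rate_mat E $ j $ k) = 0"
  by (simp add: sum.remove[of UNIV j] rate_mat_diag)

text \<open>Along the flow, the mass minus 1 solves a homogeneous linear equation; this is why mass
  1 is preserved.\<close>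

lemma sum_drift:
  assumes "irrefl E"
  shows "(\<Sum>k\<in>UNIV. drift E \<kappa> x y $ k) = \<kappa> * (x \<bullet> y) * ((\<Sum>k\<in>UNIV. x $ k) - 1)"
proof -
  have "(\<Sum>k\<in>UNIV. \<Sum>j\<in>UNIV. rate_mat E $ j $ k * x $ j) = (\<Sum>j\<in>UNIV. (\<Sum>k\<in>UNIV. rate_mat E $ j $ k) * x $ j)"
    by (subst sum.swap) (simp add: sum_distrib_right)
  also have "\<dots> = 0" by (simp add: rate_mat_row_sum[OF assms])
  finally have "(\<Sum>k\<in>UNIV. drift E \<kappa> x y $ k) = \<kappa> * (x \<bullet> y) * (\<Sum>k\<in>UNIV. x $ k) - \<kappa> * (x \<bullet> y)"
    unfolding inner_vec_def
    by (simp add: drift_nth sum.distrib sum_subtractf sum_distrib_left[symmetric] inner_vec_def mult.assoc mult.commute[of "y $ _"])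
  then show ?thesis by (simp add: algebra_simps)
qed

text \<open>The left side is half the derivative of \<open>(min (x $ i) 0)\<^sup>2\<close> along the
  flow. Off-diagonal rates are nonnegative, so among the other coordinates only negative ones can
  make it grow; the remaining terms are proportional to \<open>x $ i\<close>.\<close>

lemma min_zero_mult_drift_le:
  fixes x y :: "real ^ 'v::finite"
  assumes "irrefl E" and K: "\<bar>\<kappa> * (x \<bullet> y) - \<kappa> * y $ i\<bar> \<le> K"
  shows "min (x $ i) 0 * drift E \<kappa> x y $ i \<le> (real CARD('v) + K) * (\<Sum>j\<in>UNIV. (min (x $ j) 0)\<^sup>2)"
proof -
  let ?m = "\<lambda>j. min (x $ j) 0"
  let ?\<Phi> = "\<Sum>j\<in>UNIV. (?m j)\<^sup>2"
  have m\<Phi>: "(?m j)\<^sup>2 \<le> ?\<Phi>" for j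
    by (intro member_le_sum) auto
  have xm: "x $ i * ?m i = (?m i)\<^sup>2" by (simp add: min_def power2_eq_square)
  have term_le: "rate_mat E $ j $ i * (x $ j * ?m i) \<le> ?\<Phi>" for j
  proof (cases "j = i")
    case True
    have "rate_mat E $ i $ i \<le> 0"
      by (simp add: rate_mat_diag[OF assms(1)] sum_nonneg rate_mat_offdiag)
    then have "rate_mat E $ i $ i * (?m i)\<^sup>2 \<le> 0" by (simp add: mult_nonpos_nonneg)
    also have "0 \<le> ?\<Phi>" by (intro sum_nonneg) auto
    finally show ?thesis by (simp only: True xm)
  next
    case False
    \<comment> \<open>The factor \<open>?m i\<close> is nonpositive, so replacing
      \<open>x $ j\<close> by the smaller \<open>?m j\<close> increases the product.\<close>
    have "x $ j * ?m i \<le> ?m j * ?m i" by (intro mult_right_mono_neg) auto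
    also have "\<dots> \<le> ((?m j)\<^sup>2 + (?m i)\<^sup>2) / 2"
      using sum_squares_bound[of "?m j" "?m i"] by simp
    also have "\<dots> \<le> ?\<Phi>" using m\<Phi>[of i] m\<Phi>[of j] by simp
    finally have "x $ j * ?m i \<le> ?\<Phi>" .
    moreover have "0 \<le> ?\<Phi>" by (intro sum_nonneg) auto
    ultimately show ?thesis using False by (simp add: rate_mat_offdiag)
  qed
  have "?m i * drift E \<kappa> x y $ i =
      (\<Sum>j\<in>UNIV. rate_mat E $ j $ i * (x $ j * ?m i)) + (\<kappa> * (x \<bullet> y) - \<kappa> * y $ i) * (x $ i * ?m i)"
    by (simp add: drift_nth algebra_simps sum_distrib_left)
  also have "\<dots> \<le> (\<Sum>j\<in>(UNIV::'v set). ?\<Phi>) + K * ?\<Phi>"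
    unfolding xm using K m\<Phi>[of i] by (intro add_mono sum_mono term_le mult_mono) auto
  finally show ?thesis by (simp add: distrib_right)
qed

text \<open>Two functionals have to vanish: the squared mass defect and the sum of squared negative
  parts. Each is 0 at time 0 and obeys a linear differential inequality on \<open>{0..T}\<close>,
  with constants from compactness. \<open>y\<close> acts as a given continuous coefficient, so
  exchanging the roles covers both components.\<close>

lemma simplex_set_drift_invariant:
  fixes x y :: "real \<Rightarrow> real ^ 'v::finite"
  assumes E: "irrefl E"
    and der: "\<And>t. 0 \<le> t \<Longrightarrow> (x has_vector_derivative drift E \<kappa> (x t) (y t)) (at t within {0..})"
    and y: "continuous_on {0..} y" and x0: "x 0 \<in> simplex_set" and "0 \<le> T"
  shows "x T \<in> simplex_set"
proof -
  have der_nth: "((\<lambda>t. x t $ i) has_real_derivative drift E \<kappa> (x t) (y t) $ i) (at t within {0..})" if "0 \<le> t" for t i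
    using bounded_linear.has_vector_derivative[OF bounded_linear_vec_nth der[OF that], of i]
    by (simp add: has_real_derivative_iff_has_vector_derivative)
  have "continuous_on {0..} x"
    using der by (intro continuous_on_vector_derivative) auto
  then have cont: "continuous_on {0..T} x" "continuous_on {0..T} y"
    using y by (auto elim: continuous_on_subset)
  define k where "k i t = \<kappa> * (x t \<bullet> y t) - \<kappa> * y t $ i" for i t
  have "\<exists>B. \<forall>t\<in>{0..T}. \<bar>f t\<bar> \<le> B" if "continuous_on {0..T} f" for f :: "real \<Rightarrow> real"
    using compact_imp_bounded[OF compact_continuous_image[OF that compact_Icc]]
    by (auto simp: bounded_iff)
  note bnd = this
  have "continuous_on {0..T} (\<lambda>t. 2 * \<kappa> * (x t \<bullet> y t))"
    using cont by (intro continuous_intros)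
  from bnd[OF this] obtain B where B: "\<And>t. t \<in> {0..T} \<Longrightarrow> \<bar>2 * \<kappa> * (x t \<bullet> y t)\<bar> \<le> B" by blast
  have "\<exists>K. \<forall>t\<in>{0..T}. \<bar>k i t\<bar> \<le> K" for i
    unfolding k_def using cont by (intro bnd continuous_intros)
  then obtain K where K: "\<And>t i. t \<in> {0..T} \<Longrightarrow> \<bar>k i t\<bar> \<le> K i" by metis
  define K' where "K' = (\<Sum>i\<in>UNIV. \<bar>K i\<bar>)"
  have K': "\<bar>k i t\<bar> \<le> K'" if "t \<in> {0..T}" for i t
    using K[OF that, of i] member_le_sum[of i UNIV "\<lambda>i. \<bar>K i\<bar>"] unfolding K'_def by force
  have "((\<Sum>i\<in>UNIV. x T $ i) - 1)\<^sup>2 \<le> 0"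
  proof (rule deriv_le_mult_imp_nonpos[where \<Phi>="\<lambda>t. ((\<Sum>i\<in>UNIV. x t $ i) - 1)\<^sup>2" and T=T])
    let ?s = "\<lambda>t. \<Sum>i\<in>UNIV. x t $ i"
    show "((\<lambda>t. (?s t - 1)\<^sup>2) has_real_derivative 2 * \<kappa> * (x t \<bullet> y t) * (?s t - 1)\<^sup>2) (at t within {0..})"
      if "0 \<le> t" for t
    proof -
      have "(?s has_real_derivative \<kappa> * (x t \<bullet> y t) * (?s t - 1)) (at t within {0..})"
        unfolding sum_drift[OF E, symmetric] by (intro DERIV_sum der_nth that)
      then have d: "((\<lambda>t. ?s t - 1) has_real_derivative \<kappa> * (x t \<bullet> y t) * (?s t - 1)) (at t within {0..})"
        using DERIV_diff[OF _ DERIV_const] by fastforce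
      show ?thesis
        using DERIV_mult[OF d d] unfolding power2_eq_square by (rule DERIV_cong) simp
    qed
    show "2 * \<kappa> * (x t \<bullet> y t) * (?s t - 1)\<^sup>2 \<le> B * (?s t - 1)\<^sup>2" if "0 \<le> t" "t \<le> T" for t
      using B[of t] that by (intro mult_right_mono) auto
  qed (use x0 \<open>0 \<le> T\<close> in \<open>auto simp: simplex_set_iff\<close>)
  moreover have "(\<Sum>i\<in>UNIV. (min (x T $ i) 0)\<^sup>2) \<le> 0"
  proof (rule deriv_le_mult_imp_nonpos[where \<Phi>="\<lambda>t. \<Sum>i\<in>UNIV. (min (x t $ i) 0)\<^sup>2" and T=T])
    let ?\<Phi> = "\<lambda>t. \<Sum>i\<in>UNIV. (min (x t $ i) 0)\<^sup>2"
    show "(?\<Phi> has_real_derivative (\<Sum>i\<in>UNIV. 2 * min (x t $ i) 0 * drift E \<kappa> (x t) (y t) $ i)) (at t within {0..})"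
      if "0 \<le> t" for t
      using der_nth[OF that] by (intro DERIV_sum DERIV_chain2[OF DERIV_min_zero_square])
    show "(\<Sum>i\<in>UNIV. 2 * min (x t $ i) 0 * drift E \<kappa> (x t) (y t) $ i)
        \<le> (2 * real CARD('v) * (real CARD('v) + K')) * ?\<Phi> t" if "0 \<le> t" "t \<le> T" for t
    proof -
      have "min (x t $ i) 0 * drift E \<kappa> (x t) (y t) $ i \<le> (real CARD('v) + K') * ?\<Phi> t" for i
        using K'[of t i] that unfolding k_def by (intro min_zero_mult_drift_le E) auto
      then have "(\<Sum>i\<in>UNIV. 2 * (min (x t $ i) 0 * drift E \<kappa> (x t) (y t) $ i))
          \<le> (\<Sum>i\<in>(UNIV::'v set). 2 * ((real CARD('v) + K') * ?\<Phi> t))"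
        by (intro sum_mono mult_left_mono) auto
      then show ?thesis by (simp only: sum_constant mult_ac)
    qed
  qed (use x0 \<open>0 \<le> T\<close> in \<open>auto simp: simplex_set_iff min_absorb2\<close>)
  moreover have "(\<Sum>i\<in>UNIV. (min (x T $ i) 0)\<^sup>2) \<ge> (min (x T $ i) 0)\<^sup>2" for i
    by (rule member_le_sum) auto
  ultimately have "\<forall>i. (min (x T $ i) 0)\<^sup>2 \<le> 0" "(\<Sum>i\<in>UNIV. x T $ i) = 1"
    using order_trans by (blast, simp)
  then show ?thesis
    by (simp add: simplex_set_iff min_def) (metis linear order_refl)
qed

lemma lipschitz_domain_eq: "lipschitz_domain = simplex_set \<times> simplex_set"
  by (auto simp: lipschitz_domain_def simplex_set_def)

lemma vector_field_invariant:
  assumes E: "irrefl E"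
    and ode: "\<And>t. 0 \<le> t \<Longrightarrow> (z has_vector_derivative vector_field E \<kappa> (z t)) (at t within {0..})"
    and z0: "z 0 \<in> lipschitz_domain" and "0 \<le> t"
  shows "z t \<in> lipschitz_domain"
proof -
  let ?x = "\<lambda>t. fst (z t)" and ?y = "\<lambda>t. snd (z t)"
  have vf: "vector_field E \<kappa> (z t) = (drift E \<kappa> (?x t) (?y t), drift E \<kappa> (?y t) (?x t))" for t
    using vector_field_eq_drift[of E \<kappa> "?x t" "?y t"] by simp
  have dx: "(?x has_vector_derivative drift E \<kappa> (?x t) (?y t)) (at t within {0..})"
   and dy: "(?y has_vector_derivative drift E \<kappa> (?y t) (?x t)) (at t within {0..})" if "0 \<le> t" for t
    using bounded_linear.has_vector_derivative[OF bounded_linear_fst ode[OF that]]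
      bounded_linear.has_vector_derivative[OF bounded_linear_snd ode[OF that]]
    by (simp_all add: vf)
  have "continuous_on {0..} ?x" "continuous_on {0..} ?y"
    using dx dy by (auto intro!: continuous_on_vector_derivative)
  then have "?x t \<in> simplex_set" "?y t \<in> simplex_set"
    using simplex_set_drift_invariant[OF E dx, of t] simplex_set_drift_invariant[OF E dy, of t] z0 \<open>0 \<le> t\<close>
    by (simp_all add: lipschitz_domain_eq mem_Times_iff)
  then show ?thesis by (simp add: lipschitz_domain_eq mem_Times_iff)
qed

section \<open>Lipschitz continuity of the vector field on the product of simplices\<close>

lemma (in bounded_bilinear) lipschitz_on_bounded:
  assumes f: "K-lipschitz_on U f" and g: "L-lipschitz_on U g"
    and "bounded (f ` U)" "bounded (g ` U)"
  shows "\<exists>M. M-lipschitz_on U (\<lambda>u. prod (f u) (g u))"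
proof -
  obtain B where B: "\<And>a b. norm (prod a b) \<le> norm a * norm b * B" "0 \<le> B"
    using nonneg_bounded by blast
  obtain F where F: "\<And>u. u \<in> U \<Longrightarrow> norm (f u) \<le> F" "0 < F"
    using assms(3) by (auto simp: bounded_pos)
  obtain G where G: "\<And>u. u \<in> U \<Longrightarrow> norm (g u) \<le> G" "0 < G"
    using assms(4) by (auto simp: bounded_pos)
  have KL: "0 \<le> K" "0 \<le> L" using f g by (auto dest: lipschitz_on_nonneg)
  have "((K * G + F * L) * B)-lipschitz_on U (\<lambda>u. prod (f u) (g u))"
  proof (rule lipschitz_onI)
    fix u v assume uv: "u \<in> U" "v \<in> U"
    have "prod (f u) (g u) - prod (f v) (g v) = prod (f u - f v) (g u) + prod (f v) (g u - g v)"
      by (simp add: diff_left diff_right)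
    then have "dist (prod (f u) (g u)) (prod (f v) (g v)) \<le> norm (prod (f u - f v) (g u)) + norm (prod (f v) (g u - g v))"
      by (simp add: dist_norm norm_triangle_ineq)
    also have "\<dots> \<le> norm (f u - f v) * norm (g u) * B + norm (f v) * norm (g u - g v) * B"
      by (intro add_mono B)
    also have "\<dots> \<le> (K * dist u v) * G * B + F * (L * dist u v) * B"
      using uv F G B(2) KL lipschitz_onD[OF f uv] lipschitz_onD[OF g uv]
      by (intro add_mono mult_right_mono mult_mono) (auto simp: dist_norm less_imp_le)
    finally show "dist (prod (f u) (g u)) (prod (f v) (g v)) \<le> (K * G + F * L) * B * dist u v"
      by (simp add: algebra_simps)
  qed (use KL F G B in auto)
  then show ?thesis by blast
qed

lemma bounded_linear_lipschitz: "bounded_linear f \<Longrightarrow> \<exists>M. M-lipschitz_on U f"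
  by (meson bounded_linear.lipschitz_boundE)

lemma bounded_bilinear_diag_mat: "bounded_bilinear (\<lambda>y x. diag_mat y *v (x :: real ^ 'v::finite))"
proof -
  have "diag_mat y *v x = (\<chi> i. y $ i * x $ i)" for x y :: "real ^ 'v"
    by (simp add: vec_eq_iff matrix_vector_mult_def diag_mat_def if_distrib if_distribR sum.delta cong: if_cong)
  then show ?thesis
    by (intro bilinear_conv_bounded_bilinear[THEN iffD1])
      (auto simp: bilinear_def vec_eq_iff algebra_simps intro!: linearI)
qed

lemma lipschitz_domain_bounded: "bounded (lipschitz_domain :: ((real ^ 'v::finite) \<times> (real ^ 'v)) set)"
proof -
  have "norm x \<le> 1" if "x \<bullet> 1 = 1" "0 \<le> x" for x :: "real ^ 'v"
  proof -
    have "norm x \<le> (\<Sum>i\<in>UNIV. \<bar>x $ i\<bar>)" by (rule norm_le_l1_cart)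
    also have "\<dots> = 1" using that by (simp add: inner_vec_def less_eq_vec_def)
    finally show ?thesis .
  qed
  then have "lipschitz_domain \<subseteq> cball (0 :: real ^ 'v) 1 \<times> cball (0 :: real ^ 'v) 1"
    by (auto simp: lipschitz_domain_def)
  then show ?thesis by (rule bounded_subset[rotated]) (intro bounded_Times bounded_cball)
qed

text \<open>The field is built from the two projections by linear maps and iterated bilinear
  products, and all factors are bounded on the domain. \<open>dr\<close> keeps \<open>x\<close> and
  \<open>y\<close> abstract so as to yield both components.\<close>

lemma vector_field_lipschitz: "\<exists>M. M-lipschitz_on lipschitz_domain (vector_field E \<kappa>)"
proof -
  let ?U = "lipschitz_domain :: ((real ^ 'v) \<times> (real ^ 'v)) set"
  have comp: "\<exists>M. M-lipschitz_on ?U (\<lambda>u. f (g u))" if "bounded_linear f" "\<exists>M. M-lipschitz_on ?U g"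
    for f :: "'b::euclidean_space \<Rightarrow> 'c::euclidean_space" and g
    using that lipschitz_on_compose2 bounded_linear_lipschitz by blast
  have add: "\<exists>M. M-lipschitz_on ?U (\<lambda>u. f u + g u)" if "\<exists>M. M-lipschitz_on ?U f" "\<exists>M. M-lipschitz_on ?U g" for f g :: "_ \<Rightarrow> real ^ 'v"
    using that lipschitz_on_add by blast
  have diff: "\<exists>M. M-lipschitz_on ?U (\<lambda>u. f u - g u)" if "\<exists>M. M-lipschitz_on ?U f" "\<exists>M. M-lipschitz_on ?U g" for f g :: "_ \<Rightarrow> real ^ 'v"
    using that lipschitz_on_diff by blast
  have bdd: "bounded (f ` ?U)" if L: "\<exists>M. M-lipschitz_on ?U f" for f :: "_ \<Rightarrow> 'b::euclidean_space"
  proof -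
    obtain M where M: "M-lipschitz_on ?U f" using L ..
    then show ?thesis
      by (intro bounded_uniformly_continuous_image lipschitz_domain_bounded lipschitz_on_uniformly_continuous)
  qed
  have mult: "\<exists>M. M-lipschitz_on ?U (\<lambda>u. pr (f u) (g u))" if pr: "bounded_bilinear pr" and fg: "\<exists>M. M-lipschitz_on ?U f" "\<exists>M. M-lipschitz_on ?U g"
    for pr :: "'b::euclidean_space \<Rightarrow> 'c::euclidean_space \<Rightarrow> 'd::real_normed_vector" and f g
  proof -
    obtain K L where "K-lipschitz_on ?U f" "L-lipschitz_on ?U g" using fg by blast
    from bounded_bilinear.lipschitz_on_bounded[OF pr this bdd bdd] fg show ?thesis by blast
  qed
  have fs: "\<exists>M. M-lipschitz_on ?U fst" "\<exists>M. M-lipschitz_on ?U snd"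
    by (intro bounded_linear_lipschitz bounded_linear_fst bounded_linear_snd)+
  have inner: "\<exists>M. M-lipschitz_on ?U (\<lambda>u. \<kappa> * (fst u \<bullet> snd u))"
    by (intro comp[OF bounded_linear_mult_right] mult[OF bounded_bilinear_inner] fs)
  have dr: "\<exists>M. M-lipschitz_on ?U (\<lambda>u. transpose (rate_mat E) *v x u + (\<kappa> * (fst u \<bullet> snd u)) *\<^sub>R x u - \<kappa> *\<^sub>R (diag_mat (y u) *v x u))"
    if "\<exists>M. M-lipschitz_on ?U x" "\<exists>M. M-lipschitz_on ?U y" for x y
    using that inner
    by (intro diff add comp[OF bounded_linear_scaleR_right] comp[OF matrix_vector_mul_bounded_linear]
       mult[OF bounded_bilinear_scaleR] mult[OF bounded_bilinear_diag_mat])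
  obtain M1 M2 where
    "M1-lipschitz_on ?U (\<lambda>u. transpose (rate_mat E) *v fst u + (\<kappa> * (fst u \<bullet> snd u)) *\<^sub>R fst u - \<kappa> *\<^sub>R (diag_mat (snd u) *v fst u))"
    "M2-lipschitz_on ?U (\<lambda>u. transpose (rate_mat E) *v snd u + (\<kappa> * (fst u \<bullet> snd u)) *\<^sub>R snd u - \<kappa> *\<^sub>R (diag_mat (fst u) *v snd u))"
    using dr[OF fs] dr[OF fs(2,1)] by blast
  from lipschitz_on_Pair[OF this] show ?thesis
    unfolding vector_field_def case_prod_unfold by blast
qed

section \<open>Discrete Gronwall inequality and Euler error\<close>

text \<open>The sequence \<open>a * (1 + c) ^ k\<close> satisfies the hypothesis with equality and
  therefore dominates \<open>u\<close>.\<close>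

lemma discrete_gronwall:
  fixes u :: "nat \<Rightarrow> real"
  assumes le: "\<And>k. k \<le> m \<Longrightarrow> u k \<le> a + c * (\<Sum>l<k. u l)" and "0 \<le> a" "0 \<le> c" "k \<le> m"
  shows "u k \<le> a * exp (c * real k)"
proof -
  have geo: "a + c * (\<Sum>l<k. a * (1 + c) ^ l) = a * (1 + c) ^ k" for k
    by (induction k) (simp_all add: algebra_simps)
  have "u k \<le> a * (1 + c) ^ k" using \<open>k \<le> m\<close>
  proof (induction k rule: less_induct)
    case (less k)
    have "u k \<le> a + c * (\<Sum>l<k. u l)" by (rule le) fact
    also have "\<dots> \<le> a + c * (\<Sum>l<k. a * (1 + c) ^ l)"
      using less \<open>0 \<le> c\<close> by (intro add_left_mono mult_left_mono sum_mono) auto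
    finally show ?case by (simp add: geo)
  qed
  also have "\<dots> \<le> a * exp c ^ k"
    using \<open>0 \<le> a\<close> \<open>0 \<le> c\<close> exp_ge_add_one_self[of c] by (intro mult_left_mono power_mono) auto
  also have "exp c ^ k = exp (c * real k)"
    by (simp add: exp_of_nat2_mult)
  finally show ?thesis .
qed

lemma norm_le_sqrt_DIM:
  fixes x :: "'a::euclidean_space"
  assumes "\<And>b. b \<in> Basis \<Longrightarrow> \<bar>x \<bullet> b\<bar> \<le> \<delta>" "0 \<le> \<delta>"
  shows "norm x \<le> sqrt (real DIM('a)) * \<delta>"
proof -
  have "(norm x)\<^sup>2 = (\<Sum>b\<in>Basis. (x \<bullet> b)\<^sup>2)"
    unfolding power2_norm_eq_inner euclidean_inner[of x x] by (simp add: power2_eq_square)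
  also have "\<dots> \<le> (\<Sum>b\<in>(Basis::'a set). \<delta>\<^sup>2)"
    using assms by (intro sum_mono) (simp add: abs_le_square_iff[symmetric])
  also have "\<dots> = (sqrt (real DIM('a)) * \<delta>)\<^sup>2"
    by (simp add: power_mult_distrib)
  finally show ?thesis
    by (rule power2_le_imp_le) (simp add: \<open>0 \<le> \<delta>\<close>)
qed

text \<open>\<open>L\<close> is a Lipschitz constant in time, along the solution. Over one step
  \<open>g\<close> varies by at most \<open>L * d\<close>, so each step costs at most
  \<open>L * d * d\<close>.\<close>

lemma euler_error:
  fixes z :: "real \<Rightarrow> 'a::real_normed_vector"
  assumes der: "\<And>t. 0 \<le> t \<Longrightarrow> (z has_vector_derivative g t) (at t within {0..})"
    and lip: "L-lipschitz_on {0..} g" and d: "0 \<le> d"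
  shows "norm (z (real k * d) - z 0 - d *\<^sub>R (\<Sum>l<k. g (real l * d))) \<le> real k * (L * d * d)"
proof (induction k)
  case (Suc k)
  have "0 \<le> L" using lip by (rule lipschitz_on_nonneg)
  let ?a = "real k * d" and ?b = "real (Suc k) * d"
  have ab: "0 \<le> ?a" "?a \<le> ?b" "?b - ?a = d" using d by (auto simp: algebra_simps)
  have "norm (z ?b - z ?a - (?b - ?a) *\<^sub>R g ?a) \<le> norm (?b - ?a) * (L * d)"
  proof (rule vector_differentiable_bound_linearization[where S="{?a..?b}"])
    fix x assume x: "x \<in> {?a..?b}"
    then have x0: "0 \<le> x" "\<bar>x - ?a\<bar> \<le> d"
      using ab unfolding atLeastAtMost_iff by linarith+
    show "(z has_vector_derivative g x) (at x within {?a..?b})"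
      using x0 ab by (intro has_vector_derivative_within_subset[OF der]) auto
    have "norm (g x - g ?a) \<le> L * norm (x - ?a)"
      using x0 ab by (intro lipschitz_on_normD[OF lip]) auto
    also have "\<dots> \<le> L * d"
      using x0 \<open>0 \<le> L\<close> by (intro mult_left_mono) auto
    finally show "norm (g x - g ?a) \<le> L * d" .
  qed (use ab in \<open>auto simp: closed_segment_eq_real_ivl\<close>)
  then have step: "norm (z ?b - z ?a - d *\<^sub>R g ?a) \<le> L * d * d"
    using ab d by (simp add: mult_ac)
  have eq: "z ?b - z 0 - d *\<^sub>R (\<Sum>l<Suc k. g (real l * d)) =
      (z ?a - z 0 - d *\<^sub>R (\<Sum>l<k. g (real l * d))) + (z ?b - z ?a - d *\<^sub>R g ?a)"
    by (simp add: scaleR_add_right)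
  have "norm (z ?b - z 0 - d *\<^sub>R (\<Sum>l<Suc k. g (real l * d))) \<le> real k * (L * d * d) + L * d * d"
    unfolding eq by (rule norm_triangle_mono[OF Suc.IH step])
  then show ?case by (simp add: algebra_simps)
qed simp

lemma has_vector_derivative_bounded_lipschitz:
  fixes z :: "real \<Rightarrow> 'a::real_normed_vector"
  assumes der: "\<And>t. t \<in> S \<Longrightarrow> (z has_vector_derivative g t) (at t within S)"
    and bnd: "\<And>t. t \<in> S \<Longrightarrow> norm (g t) \<le> B" and "convex S" "0 \<le> B"
  shows "B-lipschitz_on S z"
proof (rule lipschitz_onI)
  fix s t assume "s \<in> S" "t \<in> S"
  have "norm (z s - z t) \<le> B * norm (s - t)"
  proof (rule differentiable_bound[OF \<open>convex S\<close> _ _ \<open>s \<in> S\<close> \<open>t \<in> S\<close>])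
    fix x assume x: "x \<in> S"
    show "(z has_derivative (\<lambda>h. h *\<^sub>R g x)) (at x within S)"
      using der[OF x] by (simp add: has_vector_derivative_def)
    show "onorm (\<lambda>h. h *\<^sub>R g x) \<le> B"
      using bnd[OF x] by (intro onorm_le) (simp add: mult.commute[of B] mult_left_mono)
  qed
  then show "dist (z s) (z t) \<le> B * dist s t" by (simp add: dist_norm)
qed fact

text \<open>Purely deterministic: \<open>\<mu>\<close> bounds the defect of the sequence
  \<open>x\<close> in the summed Euler recursion. Defect and Euler error of \<open>z\<close> form
  the inhomogeneity, made constant by passing from \<open>k\<close> to \<open>K\<close>, and
  Gronwall amplifies it.\<close>

lemma grid_error_le:
  fixes z :: "real \<Rightarrow> 'a::real_normed_vector" and x :: "nat \<Rightarrow> 'a"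
  assumes F: "M-lipschitz_on U F"
    and der: "\<And>t. 0 \<le> t \<Longrightarrow> (z has_vector_derivative F (z t)) (at t within {0..})"
    and lip: "L-lipschitz_on {0..} (\<lambda>t. F (z t))" and d: "0 \<le> d"
    and z: "\<And>t. 0 \<le> t \<Longrightarrow> z t \<in> U" and x: "\<And>k. x k \<in> U" "x 0 = z 0"
    and m: "\<And>k. k \<le> K \<Longrightarrow> norm (x k - x 0 - d *\<^sub>R (\<Sum>l<k. F (x l))) \<le> \<mu>"
    and "k \<le> K" "0 \<le> \<mu>"
  shows "norm (x k - z (real k * d)) \<le> (\<mu> + real K * d * L * d) * exp (M * (real K * d))"
proof -
  have L: "0 \<le> L" and M: "0 \<le> M" using lip F by (auto dest: lipschitz_on_nonneg)
  let ?u = "\<lambda>k. norm (x k - z (real k * d))"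
  have "?u k \<le> (\<mu> + real K * (L * d * d)) * exp (M * d * real k)"
  proof (rule discrete_gronwall[where m=K])
    fix k assume k: "k \<le> K"
    let ?m = "x k - x 0 - d *\<^sub>R (\<Sum>l<k. F (x l))"
    let ?e = "z (real k * d) - z 0 - d *\<^sub>R (\<Sum>l<k. F (z (real l * d)))"
    let ?D = "d *\<^sub>R (\<Sum>l<k. F (x l) - F (z (real l * d)))"
    have eq: "x k - z (real k * d) = ?m - ?e + ?D"
      using x(2) by (simp add: sum_subtractf scaleR_diff_right)
    have "?u k \<le> norm ?m + norm ?e + norm ?D"
      unfolding eq using norm_triangle_ineq[of "?m - ?e" ?D] norm_triangle_ineq4[of ?m ?e] by linarith
    also have "\<dots> \<le> \<mu> + real k * (L * d * d) + d * (\<Sum>l<k. M * ?u l)"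
    proof (intro add_mono m k euler_error[OF der lip d])
      have "norm (\<Sum>l<k. F (x l) - F (z (real l * d))) \<le> (\<Sum>l<k. M * ?u l)"
        using x z d by (intro sum_norm_le lipschitz_on_normD[OF F]) auto
      then show "norm ?D \<le> d * (\<Sum>l<k. M * ?u l)"
        using d by (simp add: mult_left_mono)
    qed
    also have "\<dots> \<le> \<mu> + real K * (L * d * d) + d * (\<Sum>l<k. M * ?u l)"
      using mult_right_mono[of "real k" "real K" "L * d * d"] k L d by simp
    finally show "?u k \<le> \<mu> + real K * (L * d * d) + M * d * (\<Sum>l<k. ?u l)"
      by (simp add: sum_distrib_left mult_ac)
  qed (use L M d \<open>0 \<le> \<mu>\<close> \<open>k \<le> K\<close> in auto)
  also have "\<dots> \<le> (\<mu> + real K * (L * d * d)) * exp (M * (real K * d))"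
    using L M d \<open>0 \<le> \<mu>\<close> \<open>k \<le> K\<close> by (intro mult_left_mono) (auto simp: mult_ac intro!: mult_left_mono)
  finally show ?thesis by (simp add: mult_ac)
qed

section \<open>Deviation probabilities: vanishing mesh and choice of the exponent\<close>

text \<open>Fatou's lemma for sets: the tail intersections increase with \<open>m\<close>, and each
  is contained in its first member.\<close>

lemma (in prob_space) prob_liminf_le:
  fixes A :: "nat \<Rightarrow> 'a set"
  assumes A: "\<And>k. A k \<in> events" and "\<forall>\<^sub>F k in sequentially. prob (A k) \<le> \<beta>"
  shows "prob (\<Union>m. \<Inter>k\<in>{m..}. A k) \<le> \<beta>"
proof -
  have sets: "(\<Inter>k\<in>{m..}. A k) \<in> events" for m
    using A by (intro sets.countable_INT') auto
  have "(\<lambda>m. prob (\<Inter>k\<in>{m..}. A k)) \<longlonglongrightarrow> prob (\<Union>m. \<Inter>k\<in>{m..}. A k)"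
    using sets by (intro finite_Lim_measure_incseq) (auto simp: incseq_def)
  moreover have "\<forall>\<^sub>F m in sequentially. prob (\<Inter>k\<in>{m..}. A k) \<le> \<beta>"
    using assms(2)
  proof eventually_elim
    case (elim m)
    have "prob (\<Inter>k\<in>{m..}. A k) \<le> prob (A m)"
      using A by (intro finite_measure_mono) auto
    with elim show ?case by simp
  qed
  ultimately show ?thesis by (intro tendsto_upperbound) auto
qed

lemma h_fun_strict_mono:
  assumes "0 \<le> x" "x < y" shows "h_fun x < h_fun y"
proof (rule DERIV_pos_imp_increasing_open[OF \<open>x < y\<close>])
  fix u assume "x < u" "u < y"
  then have "(h_fun has_real_derivative ln (1 + u)) (at u)" "0 < ln (1 + u)"
    unfolding h_fun_def using \<open>0 \<le> x\<close> by (auto intro!: derivative_eq_intros)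
  then show "\<exists>D. (h_fun has_real_derivative D) (at u) \<and> 0 < D" by blast
next
  show "continuous_on {x..y} h_fun"
    unfolding h_fun_def using \<open>0 \<le> x\<close> by (intro continuous_intros) auto
qed

lemma h_fun_pos: "0 < x \<Longrightarrow> 0 < h_fun x"
  using h_fun_strict_mono[of 0 x] by (simp add: h_fun_def)

lemma h_fun_mono: "0 \<le> x \<Longrightarrow> x \<le> y \<Longrightarrow> h_fun x \<le> h_fun y"
  using h_fun_strict_mono[of x y] by (cases "x = y") auto

text \<open>\<open>\<theta>\<close> and the coordinate tolerance \<open>\<delta>\<close> are still
  free. The strict inequality for \<open>\<epsilon>\<close> absorbs the Euler error and the grid's
  overshoot beyond \<open>T\<close>; the one for \<open>\<beta>\<close> absorbs that overshoot and
  the slack \<open>\<eta>\<close>.\<close>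

lemma (in prob_space) deviation_event:
  fixes E :: "('v::finite \<times> 'v) set" and X :: "real \<Rightarrow> 'a \<Rightarrow> (real ^ 'v) \<times> (real ^ 'v)"
  assumes E: "irrefl E" and \<kappa>: "0 \<le> \<kappa>" and n: "n \<ge> 1"
    and chain: "markov_chain M (state_space n) (jump_rate E \<kappa> n) X"
    and ode: "\<And>t. 0 \<le> t \<Longrightarrow> (z has_vector_derivative vector_field E \<kappa> (z t)) (at t within {0..})"
    and z0: "z 0 \<in> lipschitz_domain" and init: "AE \<omega> in M. X 0 \<omega> = z 0"
    and lip: "L-lipschitz_on lipschitz_domain (vector_field E \<kappa>)"
    and pos: "0 < T" "0 < \<theta>" "0 \<le> \<delta>"
    and \<delta>: "sqrt (2 * real CARD('v)) * \<delta> * exp (L * T) < \<epsilon>"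
    and \<beta>: "4 * real CARD('v) * exp (- (\<theta> * real n * \<delta>)
      + T * (real n * (real CARD('v) - 1) * (1 + \<kappa>) * phi_fun \<theta>)) < \<beta>"
  shows "\<exists>G\<in>events. {\<omega> \<in> space M. \<epsilon> \<le> (\<Squnion>t\<in>{0..T}. norm (X t \<omega> - z t))} \<subseteq> G \<and> prob G \<le> \<beta>"
proof -
  let ?F = "vector_field E \<kappa>" and ?N = "real CARD('v)"
  let ?S = "state_space n :: ((real ^ 'v) \<times> (real ^ 'v)) set"
  let ?B = "Basis :: ((real ^ 'v) \<times> (real ^ 'v)) set"
  have L: "0 \<le> L" using lip by (rule lipschitz_on_nonneg)
  have meas: "\<And>t. 0 \<le> t \<Longrightarrow> X t \<in> measurable M (count_space ?S)"
    using chain by (auto simp: markov_chain_def)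
  have XS: "X t \<omega> \<in> ?S" if "0 \<le> t" "\<omega> \<in> space M" for t \<omega>
    using measurable_space[OF meas[OF that(1)] that(2)] by simp
  have S_dom: "?S \<subseteq> lipschitz_domain"
    by (auto simp: state_space_def lattice_simplex_def lipschitz_domain_eq)
  have fin: "finite ?S"
    using markov_chain_finite_states[OF chain] .
  have zdom: "z t \<in> lipschitz_domain" if "0 \<le> t" for t
    using vector_field_invariant[OF E ode z0 that] .
  have z_cont: "continuous_on {0..} z"
    using ode by (intro continuous_on_vector_derivative) auto

  \<comment> \<open>A bounded field makes \<open>z\<close> Lipschitz in time, hence also the field
    along \<open>z\<close>; this is the constant of the Euler error.\<close>
  have "bounded (?F ` lipschitz_domain)"
    by (intro bounded_uniformly_continuous_image lipschitz_domain_bounded lipschitz_on_uniformly_continuous[OF lip])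
  then obtain B where B: "\<And>s. s \<in> lipschitz_domain \<Longrightarrow> norm (?F s) \<le> B" "0 < B"
    by (auto simp: bounded_pos)
  have "B-lipschitz_on {0..} z"
    using B zdom by (intro has_vector_derivative_bounded_lipschitz[OF ode]) auto
  then have lipFz: "(L * B)-lipschitz_on {0..} (\<lambda>t. ?F (z t))"
    by (rule lipschitz_on_compose2) (use zdom in \<open>auto intro!: lipschitz_on_subset[OF lip]\<close>)
  define L' where "L' = L * B"
  have L': "0 \<le> L'" using L B by (simp add: L'_def)

  define c where "c = real n * (?N - 1) * (1 + \<kappa>) * phi_fun \<theta>"
  have c: "0 \<le> c"
    using \<kappa> phi_fun_nonneg[of \<theta>] by (auto simp: c_def)
  \<comment> \<open>The maximal inequality demands a strict bound on the generator, so
    \<open>c\<close> is enlarged to \<open>c + \<eta>\<close>; by continuity the total stays below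
    \<open>\<beta>\<close>.\<close>
  have "((\<lambda>\<eta>. 4 * ?N * exp (- (\<theta> * real n * \<delta>) + T * (c + \<eta>))) \<longlongrightarrow>
      4 * ?N * exp (- (\<theta> * real n * \<delta>) + T * (c + 0))) (at_right 0)"
    by (intro tendsto_intros)
  from order_tendstoD(2)[OF this, of \<beta>] \<beta>
  have "\<forall>\<^sub>F \<eta> in at_right 0. 4 * ?N * exp (- (\<theta> * real n * \<delta>) + T * (c + \<eta>)) < \<beta>"
    by (simp add: c_def)
  with eventually_at_right_less[of "0::real"]
  have "\<forall>\<^sub>F \<eta> in at_right 0. 0 < \<eta> \<and> 4 * ?N * exp (- (\<theta> * real n * \<delta>) + T * (c + \<eta>)) < \<beta>"
    by eventually_elim simp
  then obtain \<eta> where \<eta>: "0 < \<eta>" "4 * ?N * exp (- (\<theta> * real n * \<delta>) + T * (c + \<eta>)) < \<beta>"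
    using eventually_happens'[OF trivial_limit_at_right_real] by blast
  \<comment> \<open>The supremum need not be attained, but the lower level
    \<open>\<epsilon>'\<close> is strictly exceeded at some time, and strict excess survives a small
    shift in time.\<close>
  obtain \<epsilon>' where \<epsilon>': "sqrt (2 * ?N) * \<delta> * exp (L * T) < \<epsilon>'" "\<epsilon>' < \<epsilon>"
    using dense[OF \<delta>] by blast

  define d where "d K = 1 / real (Suc K)" for K
  have d: "0 < d K" for K by (simp add: d_def)
  have d_lim: "d \<longlonglongrightarrow> 0"
    unfolding d_def using LIMSEQ_inverse_real_of_nat by (simp add: inverse_eq_divide)
  \<comment> \<open>The extra step provides a grid point strictly after every
    \<open>t \<le> T\<close>, at most \<open>d K\<close> beyond \<open>T\<close>.\<close>
  define m where "m K = Suc (nat \<lfloor>T / d K\<rfloor>)" for K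
  have step_le: "real (Suc (nat \<lfloor>t / d K\<rfloor>)) * d K \<le> t + d K" "t < real (Suc (nat \<lfloor>t / d K\<rfloor>)) * d K"
    if "0 \<le> t" for t K
  proof -
    have "real (nat \<lfloor>t / d K\<rfloor>) \<le> t / d K" "t / d K < real (nat \<lfloor>t / d K\<rfloor>) + 1"
      using that d[of K] by (simp_all add: floor_le_iff)
    then show "real (Suc (nat \<lfloor>t / d K\<rfloor>)) * d K \<le> t + d K" "t < real (Suc (nat \<lfloor>t / d K\<rfloor>)) * d K"
      using d[of K] by (simp_all add: field_simps)
  qed
  have m_le: "real (m K) * d K \<le> T + d K" for K
    unfolding m_def using step_le(1)[of T K] pos by simp

  define mart where "mart K k \<omega> = X (real k * d K) \<omega> - X 0 \<omega> - d K *\<^sub>R (\<Sum>l<k. ?F (X (real l * d K) \<omega>))" for K k \<omega>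
  define A where "A K b \<sigma> = {\<omega> \<in> space M. \<exists>k\<le>m K. \<theta> * real n * \<delta> \<le> \<sigma> * \<theta> * real n * (mart K k \<omega> \<bullet> b)}" for K b \<sigma>
  have fX: "(\<lambda>\<omega>. g (X (real k * d K) \<omega>)) \<in> borel_measurable M" for g :: "_ \<Rightarrow> real" and k K
    using d[of K] by (intro measurable_compose[OF meas]) auto
  have fX0: "(\<lambda>\<omega>. g (X 0 \<omega>)) \<in> borel_measurable M" for g :: "_ \<Rightarrow> real"
    by (intro measurable_compose[OF meas]) auto
  have A_sets: "A K b \<sigma> \<in> events" for K b \<sigma>
  proof -
    have "(\<lambda>\<omega>. mart K k \<omega> \<bullet> b) \<in> borel_measurable M" for k
      unfolding mart_def inner_diff_left inner_scaleR_left inner_sum_left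
      by (intro borel_measurable_diff borel_measurable_times borel_measurable_const borel_measurable_sum fX fX0)
    note [measurable] = this
    show ?thesis unfolding A_def by measurable
  qed
  have A_prob: "\<forall>\<^sub>F K in sequentially. prob (A K b \<sigma>) \<le> exp (- (\<theta> * real n * \<delta>) + (T + d K) * (c + \<eta>))"
    if b: "b \<in> ?B" and \<sigma>: "\<sigma> \<in> {1, -1}" for b \<sigma>
  proof -
    define f where "f s = \<sigma> * \<theta> * real n * (s \<bullet> b)" for s
    define g where "g s = \<sigma> * \<theta> * real n * (?F s \<bullet> b) + c + \<eta>" for s
    have "\<bar>\<sigma> * \<theta>\<bar> = \<theta>" using \<sigma> pos by auto
    then have "(\<Sum>s'\<in>?S - {s}. jump_rate E \<kappa> n s s' * (exp (f s' - f s) - 1)) < g s" if "s \<in> ?S" for s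
      using generator_exp_le[OF fin n that E \<kappa> b, of "\<sigma> * \<theta>"] \<eta>(1) by (simp add: f_def g_def c_def)
    from markov_chain_grid_maximal[OF chain this]
    have "\<forall>\<^sub>F e in at_right 0. \<forall>m a. prob {\<omega> \<in> space M. \<exists>k\<le>m. a \<le>
        f (X (real k * e) \<omega>) - f (X 0 \<omega>) - e * (\<Sum>l<k. g (X (real l * e) \<omega>))} \<le> exp (- a)" .
    moreover have "filterlim d (at_right 0) sequentially"
      using d_lim d by (auto simp: filterlim_at less_imp_neq[THEN not_sym])
    ultimately have "\<forall>\<^sub>F K in sequentially. \<forall>m a. prob {\<omega> \<in> space M. \<exists>k\<le>m. a \<le>
        f (X (real k * d K) \<omega>) - f (X 0 \<omega>) - d K * (\<Sum>l<k. g (X (real l * d K) \<omega>))} \<le> exp (- a)"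
      by (rule eventually_compose_filterlim)
    then show ?thesis
    proof eventually_elim
      case (elim K)
      \<comment> \<open>The compensator \<open>c + \<eta>\<close> accumulates over a time of at most
        \<open>T + d K\<close>. Subtracting this maximum gives one threshold for all
        \<open>k \<le> m K\<close>.\<close>
      let ?a = "\<theta> * real n * \<delta> - (T + d K) * (c + \<eta>)"
      let ?W = "{\<omega> \<in> space M. \<exists>k\<le>m K. ?a \<le>
        f (X (real k * d K) \<omega>) - f (X 0 \<omega>) - d K * (\<Sum>l<k. g (X (real l * d K) \<omega>))}"
      have eq: "f (X (real k * d K) \<omega>) - f (X 0 \<omega>) - d K * (\<Sum>l<k. g (X (real l * d K) \<omega>)) =
          \<sigma> * \<theta> * real n * (mart K k \<omega> \<bullet> b) - real k * d K * (c + \<eta>)" for k \<omega>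
        by (simp add: f_def g_def mart_def inner_diff_left inner_sum_left sum.distrib
            sum_distrib_left[symmetric] algebra_simps)
      have kd: "real k * d K * (c + \<eta>) \<le> (T + d K) * (c + \<eta>)" if "k \<le> m K" for k
      proof -
        have "real k * d K \<le> real (m K) * d K" using that d[of K] by simp
        then show ?thesis using m_le[of K] c \<eta>(1) by (intro mult_right_mono) auto
      qed
      have "A K b \<sigma> \<subseteq> ?W"
      proof
        fix \<omega> assume "\<omega> \<in> A K b \<sigma>"
        then obtain k where "\<omega> \<in> space M" "k \<le> m K" "\<theta> * real n * \<delta> \<le> \<sigma> * \<theta> * real n * (mart K k \<omega> \<bullet> b)"
          unfolding A_def by blast
        with kd[of k] show "\<omega> \<in> ?W" unfolding eq by fastforce
      qed
      moreover have "?W \<in> events"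
      proof -
        define V where "V k \<omega> = f (X (real k * d K) \<omega>) - f (X 0 \<omega>) - d K * (\<Sum>l<k. g (X (real l * d K) \<omega>))" for k \<omega>
        have [measurable]: "V k \<in> borel_measurable M" for k
          unfolding V_def by (intro borel_measurable_diff borel_measurable_times[OF borel_measurable_const]
              borel_measurable_sum fX[of f] fX[of g] fX0[of f])
        have "{\<omega> \<in> space M. \<exists>k\<le>m K. ?a \<le> V k \<omega>} \<in> events" by measurable
        then show ?thesis by (simp only: V_def)
      qed
      ultimately have "prob (A K b \<sigma>) \<le> prob ?W" by (rule finite_measure_mono)
      also have "\<dots> \<le> exp (- ?a)" using elim by blast
      finally show ?case by simp
    qed
  qed

  define A' where "A' K = (\<Union>p\<in>?B \<times> {1, -1}. A K (fst p) (snd p))" for K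
  have A'_sets: "A' K \<in> events" for K
    unfolding A'_def using A_sets by (intro sets.finite_UN) auto
  have "\<forall>\<^sub>F K in sequentially. \<forall>p\<in>?B \<times> {1, -1}. prob (A K (fst p) (snd p)) \<le> exp (- (\<theta> * real n * \<delta>) + (T + d K) * (c + \<eta>))"
    by (intro eventually_ball_finite ballI A_prob) auto
  moreover have "(\<lambda>K. 4 * ?N * exp (- (\<theta> * real n * \<delta>) + (T + d K) * (c + \<eta>)))
      \<longlonglongrightarrow> 4 * ?N * exp (- (\<theta> * real n * \<delta>) + (T + 0) * (c + \<eta>))"
    by (intro tendsto_intros d_lim)
  then have "\<forall>\<^sub>F K in sequentially. 4 * ?N * exp (- (\<theta> * real n * \<delta>) + (T + d K) * (c + \<eta>)) < \<beta>"
    by (rule order_tendstoD(2)) (use \<eta>(2) in simp)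
  ultimately have "\<forall>\<^sub>F K in sequentially. prob (A' K) \<le> \<beta>"
  proof eventually_elim
    case (elim K)
    have "prob (A' K) \<le> (\<Sum>p\<in>?B \<times> {1, -1}. prob (A K (fst p) (snd p)))"
      unfolding A'_def using A_sets by (intro finite_measure_subadditive_finite) auto
    also have "\<dots> \<le> (\<Sum>p\<in>?B \<times> {1, -1::real}. exp (- (\<theta> * real n * \<delta>) + (T + d K) * (c + \<eta>)))"
      using elim by (intro sum_mono) auto
    also have "\<dots> = 4 * ?N * exp (- (\<theta> * real n * \<delta>) + (T + d K) * (c + \<eta>))"
      by (simp add: card_cartesian_product)
    finally show ?case using elim by simp
  qed
  then have G0: "prob (\<Union>m. \<Inter>k\<in>{m..}. A' k) \<le> \<beta>"
    by (intro prob_liminf_le A'_sets)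
  have G0_sets: "(\<Union>m. \<Inter>k\<in>{m..}. A' k) \<in> events"
    using A'_sets by (intro sets.countable_UN' sets.countable_INT') auto

  \<comment> \<open>Equality at time 0 is only almost sure; the exceptional paths join the covering
    event.\<close>
  obtain N0 where N0: "{\<omega> \<in> space M. X 0 \<omega> \<noteq> z 0} \<subseteq> N0" "N0 \<in> events" "prob N0 = 0"
    using init by (auto elim!: AE_E simp: measure_def)

  have incl: "\<omega> \<in> (\<Union>m. \<Inter>k\<in>{m..}. A' k)"
    if \<omega>: "\<omega> \<in> space M" "X 0 \<omega> = z 0" and sup: "\<epsilon> \<le> (\<Squnion>t\<in>{0..T}. norm (X t \<omega> - z t))" for \<omega>
  proof -
    have "\<exists>t\<in>{0..T}. \<epsilon>' < norm (X t \<omega> - z t)"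
    proof (rule ccontr)
      assume "\<not> ?thesis"
      then have "(\<Squnion>t\<in>{0..T}. norm (X t \<omega> - z t)) \<le> \<epsilon>'"
        using pos by (intro cSUP_least) (auto simp: not_less)
      with sup \<epsilon>'(2) show False by simp
    qed
    then obtain t where t: "0 \<le> t" "t \<le> T" "\<epsilon>' < norm (X t \<omega> - z t)" by auto
    \<comment> \<open>After \<open>t\<close> the chain stays put for a time \<open>d0\<close> and
      \<open>z\<close> moves continuously, so the excess persists on a right neighbourhood of
      \<open>t\<close>, which every fine grid meets.\<close>
    have "\<forall>\<omega>\<in>space M. \<forall>t\<ge>0. \<exists>d>0. \<forall>u\<in>{t..<t + d}. X u \<omega> = X t \<omega>"
      using chain unfolding markov_chain_def by (elim conjE)
    then obtain d0 where d0: "0 < d0" "\<And>u. u \<in> {t..<t + d0} \<Longrightarrow> X u \<omega> = X t \<omega>"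
      using \<omega>(1) t(1) by meson
    have "((\<lambda>u. norm (X t \<omega> - z u)) \<longlongrightarrow> norm (X t \<omega> - z t)) (at t within {0..})"
      using z_cont t by (intro tendsto_intros) (auto simp: continuous_on_def)
    from order_tendstoD(1)[OF this t(3)] obtain d1 where d1: "0 < d1"
      "\<And>u. 0 \<le> u \<Longrightarrow> u \<noteq> t \<Longrightarrow> dist u t < d1 \<Longrightarrow> \<epsilon>' < norm (X t \<omega> - z u)"
      by (auto simp: eventually_at)
    have "\<forall>\<^sub>F K in sequentially. d K < min d0 d1"
      using d0(1) d1(1) by (intro order_tendstoD(2)[OF d_lim]) simp
    moreover have "(\<lambda>K. (sqrt (2 * ?N) * \<delta> + (T + d K) * L' * d K) * exp (L * (T + d K)))
        \<longlonglongrightarrow> (sqrt (2 * ?N) * \<delta> + (T + 0) * L' * 0) * exp (L * (T + 0))"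
      by (intro tendsto_intros d_lim)
    then have "\<forall>\<^sub>F K in sequentially. (sqrt (2 * ?N) * \<delta> + (T + d K) * L' * d K) * exp (L * (T + d K)) < \<epsilon>'"
      by (rule order_tendstoD(2)) (use \<epsilon>'(1) in simp)
    ultimately have "\<forall>\<^sub>F K in sequentially. \<omega> \<in> A' K"
    proof eventually_elim
      case (elim K)
      \<comment> \<open>The first grid point strictly after \<open>t\<close>; the path before
        \<open>t\<close> may differ from its value at \<open>t\<close>.\<close>
      define k where "k = Suc (nat \<lfloor>t / d K\<rfloor>)"
      let ?t = "real k * d K"
      have k: "t < ?t" "?t \<le> t + d K"
        using step_le[OF t(1), of K] by (simp_all add: k_def)
      have km: "k \<le> m K"
        unfolding k_def m_def using t d[of K] by (auto intro!: nat_mono floor_mono divide_right_mono)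
      have "\<epsilon>' < norm (X ?t \<omega> - z ?t)"
      proof -
        have "?t \<in> {t..<t + d0}" "dist ?t t < d1" "0 \<le> ?t" "?t \<noteq> t"
          using k t(1) elim(1) by (auto simp: dist_real_def)
        then show ?thesis using d0(2) d1(2) by metis
      qed
      moreover have "norm (X ?t \<omega> - z ?t) \<le> (sqrt (2 * ?N) * \<delta> + real (m K) * d K * L' * d K) * exp (L * (real (m K) * d K))"
        if "\<And>j. j \<le> m K \<Longrightarrow> norm (mart K j \<omega>) \<le> sqrt (2 * ?N) * \<delta>"
      proof (rule grid_error_le[OF lip ode lipFz[folded L'_def] _ zdom, where x="\<lambda>k. X (real k * d K) \<omega>"])
        show "X (real k * d K) \<omega> \<in> lipschitz_domain" for k
          using XS[OF _ \<omega>(1)] S_dom d[of K] by auto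
        show "norm (X (real k * d K) \<omega> - X (real 0 * d K) \<omega> - d K *\<^sub>R (\<Sum>l<k. ?F (X (real l * d K) \<omega>)))
            \<le> sqrt (2 * ?N) * \<delta>" if "k \<le> m K" for k
          using \<open>\<And>j. j \<le> m K \<Longrightarrow> norm (mart K j \<omega>) \<le> sqrt (2 * ?N) * \<delta>\<close>[OF that] by (simp add: mart_def)
      qed (use d[of K] km \<omega>(2) pos in auto)
      moreover have "(sqrt (2 * ?N) * \<delta> + real (m K) * d K * L' * d K) * exp (L * (real (m K) * d K))
          \<le> (sqrt (2 * ?N) * \<delta> + (T + d K) * L' * d K) * exp (L * (T + d K))"
        using m_le[of K] L L' d[of K] pos
        by (intro mult_mono add_mono mult_right_mono exp_le_cancel_iff[THEN iffD2] mult_left_mono) auto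
      \<comment> \<open>Were all \<open>mart K j\<close> small, the grid error would stay below
        \<open>\<epsilon>'\<close> by \<open>elim(2)\<close>.\<close>
      ultimately obtain j where j: "j \<le> m K" "sqrt (2 * ?N) * \<delta> < norm (mart K j \<omega>)"
        using elim(2) by fastforce
      have "\<exists>b\<in>?B. \<delta> < \<bar>mart K j \<omega> \<bullet> b\<bar>"
      proof (rule ccontr)
        assume "\<not> ?thesis"
        then have "norm (mart K j \<omega>) \<le> sqrt (real DIM((real ^ 'v) \<times> (real ^ 'v))) * \<delta>"
          using pos by (intro norm_le_sqrt_DIM) (auto simp: not_less)
        with j(2) show False by simp
      qed
      then obtain b where b: "b \<in> ?B" "\<delta> < \<bar>mart K j \<omega> \<bullet> b\<bar>" by blast
      define \<sigma> where "\<sigma> = (if 0 \<le> mart K j \<omega> \<bullet> b then 1 else -1 :: real)"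
      have "\<delta> \<le> \<sigma> * (mart K j \<omega> \<bullet> b)" using b(2) by (auto simp: \<sigma>_def)
      then have "\<theta> * real n * \<delta> \<le> \<theta> * real n * (\<sigma> * (mart K j \<omega> \<bullet> b))"
        using pos by (intro mult_left_mono) auto
      then have "\<omega> \<in> A K b \<sigma>"
        unfolding A_def using j(1) \<omega>(1) by (auto simp: mult_ac)
      moreover have "\<sigma> \<in> {1, -1}" by (simp add: \<sigma>_def)
      ultimately show ?case unfolding A'_def using b(1) by force
    qed
    then show ?thesis by (auto simp: eventually_sequentially)
  qed

  show ?thesis
  proof (intro bexI conjI)
    let ?G = "(\<Union>m. \<Inter>k\<in>{m..}. A' k) \<union> N0"
    show "?G \<in> events" using G0_sets N0 by auto
    show "{\<omega> \<in> space M. \<epsilon> \<le> (\<Squnion>t\<in>{0..T}. norm (X t \<omega> - z t))} \<subseteq> ?G"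
      using incl N0(1) by blast
    have "prob ?G \<le> prob (\<Union>m. \<Inter>k\<in>{m..}. A' k) + prob N0"
      using G0_sets N0 by (intro measure_Un_le) auto
    then show "prob ?G \<le> \<beta>" using G0 N0 by simp
  qed
qed

lemma (in prob_space) deviation_event_h_fun:
  fixes E :: "('v::finite \<times> 'v) set" and X :: "real \<Rightarrow> 'a \<Rightarrow> (real ^ 'v) \<times> (real ^ 'v)"
  assumes E: "irrefl E" and \<kappa>: "0 \<le> \<kappa>" and n: "n \<ge> 1"
    and chain: "markov_chain M (state_space n) (jump_rate E \<kappa> n) X"
    and ode: "\<And>t. 0 \<le> t \<Longrightarrow> (z has_vector_derivative vector_field E \<kappa> (z t)) (at t within {0..})"
    and z0: "z 0 \<in> lipschitz_domain" and init: "AE \<omega> in M. X 0 \<omega> = z 0"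
    and lip: "L-lipschitz_on lipschitz_domain (vector_field E \<kappa>)"
    and pos: "0 < T" "0 < \<epsilon>" and N: "CARD('v) \<ge> 2"
    and \<beta>: "4 * real CARD('v) * (real CARD('v) - 1) * exp (- (real n * (1 + \<kappa>) * T *
        h_fun (\<epsilon> * exp (- (L * T)) / (sqrt 2 * real CARD('v) * (real CARD('v) - 1) * (1 + \<kappa>) * T)))) < \<beta>"
  shows "\<exists>G\<in>events. {\<omega> \<in> space M. \<epsilon> \<le> (\<Squnion>t\<in>{0..T}. norm (X t \<omega> - z t))} \<subseteq> G \<and> prob G \<le> \<beta>"
proof -
  define N where "N = real CARD('v)"
  have N2: "N \<ge> 2" using N by (simp add: N_def)
  define a where "a = (1 + \<kappa>) * T"
  have a: "0 < a" using \<kappa> pos by (simp add: a_def)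
  define \<epsilon>' where "\<epsilon>' = \<epsilon> * exp (- (L * T))"
  have \<epsilon>': "0 < \<epsilon>'" using pos by (simp add: \<epsilon>'_def)
  define y0 where "y0 = \<epsilon>' / (sqrt 2 * N * (N - 1) * a)"
  \<comment> \<open>\<open>\<delta>'\<close> is the tolerance at which the norm bound equals
    \<open>\<epsilon>\<close>. \<open>y\<close> compares it with \<open>(N - 1) * a\<close>, which
    bounds the jump rate of a coordinate times \<open>T / n\<close>; then
    \<open>\<theta> = ln (1 + y)\<close> minimises the exponent, as for a Poisson variable.\<close>
  define \<delta>' where "\<delta>' = \<epsilon>' / sqrt (2 * N)"
  define y where "y = \<delta>' / ((N - 1) * a)"
  define \<theta> where "\<theta> = ln (1 + y)"
  have \<delta>': "0 < \<delta>'" using \<epsilon>' N2 by (simp add: \<delta>'_def)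
  have y: "0 < y" using \<delta>' N2 a by (simp add: y_def)
  have \<theta>: "0 < \<theta>" using y by (simp add: \<theta>_def)
  have y0: "0 \<le> y0" using \<epsilon>' N2 a by (simp add: y0_def)
  \<comment> \<open>Used with \<open>r = sqrt N\<close>, so that \<open>r * r\<close> is the factor
    \<open>N\<close> in \<open>y0\<close>.\<close>
  have "\<epsilon>' / (sqrt 2 * r) / ((N - 1) * a) = r * (\<epsilon>' / (sqrt 2 * (r * r) * (N - 1) * a))" if "0 < r" for r
    using that by simp
  from this[of "sqrt N"] have "y = sqrt N * y0"
    using N2 by (simp add: y_def y0_def \<delta>'_def real_sqrt_mult)
  moreover have "1 \<le> sqrt N" using N2 by simp
  ultimately have "y0 \<le> y" using mult_right_mono[of 1 "sqrt N" y0] y0 by simp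
  with y0 have "h_fun y0 \<le> h_fun y" by (rule h_fun_mono)
  also have "\<dots> \<le> (N - 1) * h_fun y"
    using N2 h_fun_pos[OF y] mult_right_mono[of 1 "N - 1" "h_fun y"] by simp
  finally have h: "a * h_fun y0 \<le> a * ((N - 1) * h_fun y)"
    using a by (intro mult_left_mono) auto
  have subst: "\<delta>' = (N - 1) * ((1 + \<kappa>) * T) * y" "phi_fun \<theta> = y - \<theta>" "h_fun y = (1 + y) * \<theta> - y"
    using N2 a y by (simp_all add: y_def[symmetric] a_def[symmetric] \<theta>_def phi_fun_def h_fun_def)
      (simp add: y_def)
  have exponent: "- (\<theta> * real n * \<delta>') + T * (real n * (N - 1) * (1 + \<kappa>) * phi_fun \<theta>)
      = - (real n * (a * ((N - 1) * h_fun y)))"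
    unfolding a_def subst by (simp add: algebra_simps)
  have "4 * N * exp (- (real n * (a * ((N - 1) * h_fun y)))) \<le> 4 * N * (N - 1) * exp (- (real n * (a * h_fun y0)))"
  proof (rule mult_mono)
    show "4 * N \<le> 4 * N * (N - 1)" using N2 by (simp add: mult_le_cancel_left1)
  qed (use h N2 in \<open>auto simp: mult_left_mono\<close>)
  also have "\<dots> < \<beta>"
    using \<beta> by (simp add: N_def a_def y0_def \<epsilon>'_def mult_ac)
  finally have less: "4 * N * exp (- (\<theta> * real n * \<delta>') + T * (real n * (N - 1) * (1 + \<kappa>) * phi_fun \<theta>)) < \<beta>"
    unfolding exponent .
  \<comment> \<open>At \<open>\<delta>'\<close> the norm condition is an equality; a slightly
    smaller \<open>\<delta>\<close> makes it strict and, by continuity, keeps the probability bound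
    below \<open>\<beta>\<close>.\<close>
  have "((\<lambda>\<delta>. 4 * N * exp (- (\<theta> * real n * \<delta>) + T * (real n * (N - 1) * (1 + \<kappa>) * phi_fun \<theta>))) \<longlongrightarrow>
      4 * N * exp (- (\<theta> * real n * \<delta>') + T * (real n * (N - 1) * (1 + \<kappa>) * phi_fun \<theta>))) (at_left \<delta>')"
    by (intro tendsto_intros)
  from order_tendstoD(2)[OF this less] eventually_at_left_real[OF \<delta>']
  have "\<forall>\<^sub>F \<delta> in at_left \<delta>'. 0 < \<delta> \<and> \<delta> < \<delta>' \<and>
      4 * N * exp (- (\<theta> * real n * \<delta>) + T * (real n * (N - 1) * (1 + \<kappa>) * phi_fun \<theta>)) < \<beta>"
    by eventually_elim auto
  then obtain \<delta> where \<delta>: "0 < \<delta>" "\<delta> < \<delta>'"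
      "4 * N * exp (- (\<theta> * real n * \<delta>) + T * (real n * (N - 1) * (1 + \<kappa>) * phi_fun \<theta>)) < \<beta>"
    using eventually_happens'[OF trivial_limit_at_left_real] by blast
  have "sqrt (2 * N) * \<delta> * exp (L * T) < sqrt (2 * N) * \<delta>' * exp (L * T)"
    using \<delta> N2 by simp
  also have "\<dots> = \<epsilon>"
    using N2 by (simp add: \<delta>'_def \<epsilon>'_def exp_minus field_simps)
  finally show ?thesis
    using deviation_event[OF E \<kappa> n chain ode z0 init lip pos(1) \<theta> less_imp_le[OF \<delta>(1)]] \<delta>(3)
    by (simp add: N_def)
qed

theorem theorem3p4:
  fixes E :: "('v::finite \<times> 'v) set"
    and \<kappa> :: real
    and P :: "'w measure"
    and X :: "nat \<Rightarrow> real \<Rightarrow> 'w \<Rightarrow> (real ^ 'v) \<times> (real ^ 'v)"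
    and z :: "real \<Rightarrow> (real ^ 'v) \<times> (real ^ 'v)"
    and N :: real
  defines "N \<equiv> real CARD('v)"
  assumes graph: "connected_graph E"
    and kappa: "\<kappa> > 0"
    and prob: "prob_space P"
    and chain: "\<forall>n\<ge>1. markov_chain P (state_space n) (jump_rate E \<kappa> n) (X n)"
    and ode: "\<forall>t\<ge>0. (z has_vector_derivative vector_field E \<kappa> (z t)) (at t within {0..})"
    and ode_init: "fst (z 0) \<bullet> 1 = 1" "snd (z 0) \<bullet> 1 = 1"
    and init: "\<forall>n\<ge>1. AE \<omega> in P. X n 0 \<omega> = z 0"
  shows "(\<forall>T>0. AE \<omega> in P. (\<lambda>n. \<Squnion>t\<in>{0..T}. norm (X n t \<omega> - z t)) \<longlonglongrightarrow> 0) \<and>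
    (\<exists>M. M-lipschitz_on lipschitz_domain (vector_field E \<kappa>)) \<and>
    (\<forall>M. M-lipschitz_on lipschitz_domain (vector_field E \<kappa>) \<longrightarrow>
      (\<forall>n\<ge>1. \<forall>\<epsilon>>0. \<forall>T>0.
        measure P {\<omega> \<in> space P. (\<Squnion>t\<in>{0..T}. norm (X n t \<omega> - z t)) \<ge> \<epsilon>}
          \<le> 4 * N * (N - 1) *
             exp (- (real n * (1 + \<kappa>) * T *
                h_fun (\<epsilon> * exp (- (M * T)) / (sqrt 2 * N * (N - 1) * (1 + \<kappa>) * T))))))"
proof -
  interpret prob_space P by fact
  have E: "irrefl E" using graph by (simp add: connected_graph_def)
  have XS: "X n t \<omega> \<in> lipschitz_domain" if "n \<ge> 1" "0 \<le> t" "\<omega> \<in> space P" for n t \<omega>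
  proof -
    have "X n t \<in> measurable P (count_space (state_space n))"
      using chain[rule_format, OF that(1)] that(2) by (simp add: markov_chain_def)
    from measurable_space[OF this that(3)] show ?thesis
      by (auto simp: state_space_def lattice_simplex_def lipschitz_domain_eq)
  qed
  \<comment> \<open>\<open>ode_init\<close> fixes only the masses. Nonnegativity of
    \<open>z 0\<close> comes from the chain with \<open>n = 1\<close>; a statement free of
    \<open>\<omega>\<close> that holds almost surely is true.\<close>
  have "AE \<omega> in P. z 0 \<in> lipschitz_domain"
    using init[rule_format, OF order_refl] AE_space
  proof eventually_elim
    case (elim \<omega>)
    with XS[of 1 0 \<omega>] show ?case by simp
  qed
  then have z0: "z 0 \<in> lipschitz_domain" by simp
  have z_dom: "z t \<in> lipschitz_domain" if "0 \<le> t" for t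
    using vector_field_invariant[OF E ode[rule_format] z0 that] by simp
  let ?sup = "\<lambda>n T \<omega>. \<Squnion>t\<in>{0..T}. norm (X n t \<omega> - z t)"
  define bound where "bound M n \<epsilon> T = 4 * N * (N - 1) * exp (- (real n * (1 + \<kappa>) * T *
      h_fun (\<epsilon> * exp (- (M * T)) / (sqrt 2 * N * (N - 1) * (1 + \<kappa>) * T))))" for M n \<epsilon> T
  have event: "\<exists>G\<in>events. {\<omega> \<in> space P. \<epsilon> \<le> ?sup n T \<omega>} \<subseteq> G \<and> prob G \<le> \<beta>"
    if "n \<ge> 1" "0 < \<epsilon>" "0 < T" "M-lipschitz_on lipschitz_domain (vector_field E \<kappa>)" "bound M n \<epsilon> T < \<beta>"
    for n \<epsilon> T M \<beta>
  proof (cases "CARD('v) = 1")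
    case True
    \<comment> \<open>For a single node \<open>bound\<close> is 0, and the event is empty because
      chain and solution are confined to the same point.\<close>
    then obtain v :: 'v where UNIV: "UNIV = {v}" by (metis card_1_singletonE)
    have one: "u $ i = 1" if "u \<in> simplex_set" for u :: "real ^ 'v" and i
    proof -
      have "i = v" using UNIV by auto
      with that show ?thesis by (simp add: simplex_set_iff UNIV)
    qed
    have eq: "s = s'" if "s \<in> lipschitz_domain" "s' \<in> lipschitz_domain" for s s' :: "(real ^ 'v) \<times> (real ^ 'v)"
      using that by (simp add: lipschitz_domain_eq mem_Times_iff prod_eq_iff vec_eq_iff one)
    have "\<not> \<epsilon> \<le> ?sup n T \<omega>" if "\<omega> \<in> space P" for \<omega>
    proof -
      have "?sup n T \<omega> = (\<Squnion>t\<in>{0..T}. 0)"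
        using eq[OF XS[OF \<open>n \<ge> 1\<close> _ that] z_dom] by (intro SUP_cong) auto
      then show ?thesis using \<open>0 < T\<close> \<open>0 < \<epsilon>\<close> by simp
    qed
    then have "{\<omega> \<in> space P. \<epsilon> \<le> ?sup n T \<omega>} \<subseteq> {}" by blast
    moreover have "prob {} \<le> \<beta>" using that(5) True by (simp add: bound_def N_def)
    ultimately show ?thesis by blast
  next
    case False
    then have "CARD('v) \<ge> 2" using zero_less_card_finite[where 'a='v] by linarith
    then show ?thesis
      using deviation_event_h_fun[OF E _ that(1) chain[rule_format, OF that(1)] ode[rule_format] z0
          init[rule_format, OF that(1)] that(4,3,2), of \<beta>] that(5) kappa
      by (simp add: bound_def N_def)
  qed
  have part3: "measure P {\<omega> \<in> space P. \<epsilon> \<le> ?sup n T \<omega>} \<le> bound M n \<epsilon> T"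
    if "n \<ge> 1" "0 < \<epsilon>" "0 < T" "M-lipschitz_on lipschitz_domain (vector_field E \<kappa>)" for n \<epsilon> T M
  proof (rule dense_ge)
    \<comment> \<open>\<open>\<beta>\<close> decreases to the bound; monotonicity of the measure
      uses measurability of the covering event \<open>G\<close>.\<close>
    fix \<beta> assume "bound M n \<epsilon> T < \<beta>"
    from event[OF that this] obtain G where "G \<in> events" "{\<omega> \<in> space P. \<epsilon> \<le> ?sup n T \<omega>} \<subseteq> G" "prob G \<le> \<beta>"
      by blast
    then show "measure P {\<omega> \<in> space P. \<epsilon> \<le> ?sup n T \<omega>} \<le> \<beta>"
      using finite_measure_mono by (meson order_trans)
  qed
  obtain M where M: "M-lipschitz_on lipschitz_domain (vector_field E \<kappa>)"
    using vector_field_lipschitz by blast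
  have part1: "AE \<omega> in P. (\<lambda>n. ?sup n T \<omega>) \<longlonglongrightarrow> 0" if T: "0 < T" for T
  proof -
    have small: "AE \<omega> in P. \<forall>\<^sub>F n in sequentially. ?sup n T \<omega> < \<epsilon>" if \<epsilon>: "0 < \<epsilon>" for \<epsilon>
    proof -
      define r where "r = exp (- ((1 + \<kappa>) * T * h_fun (\<epsilon> * exp (- (M * T)) / (sqrt 2 * N * (N - 1) * (1 + \<kappa>) * T))))"
      have bound_r: "bound M n \<epsilon> T = 4 * N * (N - 1) * r ^ n" for n
        by (simp add: bound_def r_def exp_of_nat_mult[symmetric] mult_ac)
      \<comment> \<open>\<open>event\<close> needs a value strictly above \<open>bound\<close>; the
        surplus \<open>(1/2) ^ n\<close> is summable. The shift to \<open>Suc n\<close> ensures an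
        index of at least 1.\<close>
      have "\<exists>G\<in>events. {\<omega> \<in> space P. \<epsilon> \<le> ?sup (Suc n) T \<omega>} \<subseteq> G \<and> prob G \<le> bound M (Suc n) \<epsilon> T + (1/2) ^ n" for n
        by (rule event[OF _ \<epsilon> T M]) simp_all
      then have "\<forall>n. \<exists>G. G \<in> events \<and> {\<omega> \<in> space P. \<epsilon> \<le> ?sup (Suc n) T \<omega>} \<subseteq> G \<and>
          prob G \<le> bound M (Suc n) \<epsilon> T + (1/2) ^ n" by blast
      from choice[OF this] obtain G where "\<forall>n. G n \<in> events \<and> {\<omega> \<in> space P. \<epsilon> \<le> ?sup (Suc n) T \<omega>} \<subseteq> G n \<and>
          prob (G n) \<le> bound M (Suc n) \<epsilon> T + (1/2) ^ n" ..
      then have G: "G n \<in> events" "{\<omega> \<in> space P. \<epsilon> \<le> ?sup (Suc n) T \<omega>} \<subseteq> G n"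
          "prob (G n) \<le> bound M (Suc n) \<epsilon> T + (1/2) ^ n" for n
        by blast+
      have "summable (\<lambda>n. bound M (Suc n) \<epsilon> T)"
      proof (cases "CARD('v) = 1")
        case True then show ?thesis by (simp add: bound_def N_def)
      next
        case False
        then have "N \<ge> 2" using zero_less_card_finite[where 'a='v] unfolding N_def by linarith
        then have "0 < (1 + \<kappa>) * T * h_fun (\<epsilon> * exp (- (M * T)) / (sqrt 2 * N * (N - 1) * (1 + \<kappa>) * T))"
          using \<epsilon> T kappa by (intro mult_pos_pos h_fun_pos divide_pos_pos) auto
        then have "0 < r" "r < 1" by (auto simp: r_def)
        then have "summable (\<lambda>n. r ^ Suc n)"
          by (subst summable_Suc_iff) (auto intro: summable_geometric)
        then show ?thesis unfolding bound_r by (rule summable_mult)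
      qed
      then have "summable (\<lambda>n. bound M (Suc n) \<epsilon> T + (1/2) ^ n)"
        by (rule summable_add) (auto intro: summable_geometric)
      then have "summable (\<lambda>n. prob (G n))"
        by (rule summable_comparison_test'[where N=0]) (use G(3) in simp)
      from borel_cantelli_AE1[OF G(1) _ this]
      have "AE \<omega> in P. \<forall>\<^sub>F n in sequentially. \<omega> \<in> space P - G n"
        by (simp add: less_top[symmetric])
      then show ?thesis
      proof eventually_elim
        case (elim \<omega>)
        then have "\<forall>\<^sub>F n in sequentially. ?sup (Suc n) T \<omega> < \<epsilon>"
        proof eventually_elim
          case (elim n)
          then have "\<omega> \<notin> {\<omega> \<in> space P. \<epsilon> \<le> ?sup (Suc n) T \<omega>}" "\<omega> \<in> space P"
            using G(2)[of n] by blast+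
          then show ?case by (simp add: not_le)
        qed
        then show ?case by (simp only: eventually_sequentially_Suc[where P="\<lambda>n. ?sup n T \<omega> < \<epsilon>"])
      qed
    qed
    \<comment> \<open>Countably many levels suffice, so their null sets can be united.\<close>
    have "AE \<omega> in P. \<forall>k. \<forall>\<^sub>F n in sequentially. ?sup n T \<omega> < inverse (real (Suc k))"
      unfolding AE_all_countable by (intro allI small) simp
    then show ?thesis
      using AE_space
    proof eventually_elim
      case (elim \<omega>)
      \<comment> \<open>A real supremum is an upper bound only for sets bounded above, so
        boundedness precedes the comparison with the value at time 0.\<close>
      have nonneg: "0 \<le> ?sup n T \<omega>" if "n \<ge> 1" for n
      proof -
        have "bounded ((\<lambda>t. norm (X n t \<omega> - z t)) ` {0..T})"
        proof -
          obtain B where B: "\<And>s. s \<in> lipschitz_domain \<Longrightarrow> norm (s :: (real ^ 'v) \<times> (real ^ 'v)) \<le> B"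
            using lipschitz_domain_bounded by (auto simp: bounded_iff)
          have "norm (X n t \<omega> - z t) \<le> B + B" if "0 \<le> t" for t
            using B[OF XS[OF \<open>n \<ge> 1\<close> that elim(2)]] B[OF z_dom[OF that]]
            by (intro order_trans[OF norm_triangle_ineq4] add_mono)
          then show ?thesis unfolding bounded_iff by (intro exI[of _ "B + B"]) auto
        qed
        then have "norm (X n 0 \<omega> - z 0) \<le> ?sup n T \<omega>"
          using T by (intro cSUP_upper bounded_imp_bdd_above) auto
        then show ?thesis using norm_ge_zero order_trans by blast
      qed
      show ?case
      proof (rule tendstoI)
        fix e :: real assume "0 < e"
        then obtain k where k: "inverse (real (Suc k)) < e" using reals_Archimedean by blast
        from elim(1)[rule_format, of k] eventually_ge_at_top[of 1]
        show "\<forall>\<^sub>F n in sequentially. dist (?sup n T \<omega>) 0 < e"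
        proof eventually_elim
          case (elim n) with nonneg[of n] k show ?case by simp
        qed
      qed
    qed
  qed
  show ?thesis
    using part1 part3 vector_field_lipschitz[of E \<kappa>] unfolding bound_def by (intro conjI allI impI)
qed

end
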